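(* There exist $\alpha\in\mathbb{R}$ and a finite positive Borel measure $\rho$ on $\mathbb{R}$, absolutely continuous relative to Lebesgue measure, such that for the analytic function $\Phi:\mathbb{C}^{+}\to\mathbb{C}^{+}$ given by $$\Phi(z)=\alpha+z+\int_{-\infty}^{\infty}\frac{1+tz}{t-z}\,d\rho(t),\qquad z\in\mathbb{C}^{+},$$ the composition operator $C_\Phi$ on $H^2_{\mathbb{C}^+}$ is similar to an isometry but is not itself an isometry.
   Context: $\mathbb{C}^{+}=\{x+iy:y>0\}$ is the open upper half-plane. $H^2_{\mathbb{C}^+}$ is the Hardy space of analytic functions $u:\mathbb{C}^+\to\mathbb{C}$ with $\|u\|_2^2=\sup_{y>0}\int_{-\infty}^{\infty}|u(x+iy)|^2\,dx<\infty$; it is a Hilbert space. The composition operator is $C_\Phi u=u\circ\Phi$; for $\Phi$ of the form $\Phi(z)=\alpha+z+\int_{-\infty}^{\infty}\frac{1+tz}{t-z}\,d\rho(t)$, $z\in\mathbb{C}^{+}$, with $\alpha\in\mathbb{R}$ and $\rho$ a finite positive Borel measure on $\mathbb{R}$, it is known to be a contraction on $H^2_{\mathbb{C}^+}$. A bounded operator $T$ on a Hilbert space $H$ is similar to an isometry if there are a Hilbert space $K$, a bounded invertible operator $S:H\to K$ with bounded inverse, and a linear isometry $V:K\to K$ such that $T=S^{-1}VS$. *)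

theory Defs
  imports "HOL-Complex_Analysis.Complex_Analysis" "HOL-Probability.Probability"
begin

section \<open>Complex Hilbert spaces on explicit carriers\<close>

text \<open>
  The operations are only meaningful on the carrier. A carrier-based notion is used, rather than
  a type class, so that one can quantify existentially over Hilbert spaces.
\<close>

record 'a normed_struct =
  vecs :: "'a set"
  vzero :: 'a
  vadd :: "'a \<Rightarrow> 'a \<Rightarrow> 'a"
  vscale :: "complex \<Rightarrow> 'a \<Rightarrow> 'a"
  vnorm :: "'a \<Rightarrow> real"

definition vdiff :: "('a, 'm) normed_struct_scheme \<Rightarrow> 'a \<Rightarrow> 'a \<Rightarrow> 'a" where
  "vdiff K x y = vadd K x (vscale K (- 1) y)"

locale complex_vector_space =
  fixes K :: "('a, 'm) normed_struct_scheme" (structure)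
  assumes zero_closed: "vzero K \<in> vecs K"
    and add_closed: "\<lbrakk>x \<in> vecs K; y \<in> vecs K\<rbrakk> \<Longrightarrow> vadd K x y \<in> vecs K"
    and scale_closed: "x \<in> vecs K \<Longrightarrow> vscale K c x \<in> vecs K"
    and add_assoc: "\<lbrakk>x \<in> vecs K; y \<in> vecs K; z \<in> vecs K\<rbrakk>
                      \<Longrightarrow> vadd K (vadd K x y) z = vadd K x (vadd K y z)"
    and add_commute: "\<lbrakk>x \<in> vecs K; y \<in> vecs K\<rbrakk> \<Longrightarrow> vadd K x y = vadd K y x"
    and add_zero: "x \<in> vecs K \<Longrightarrow> vadd K (vzero K) x = x"
    and add_inverse: "x \<in> vecs K \<Longrightarrow> \<exists>y\<in>vecs K. vadd K x y = vzero K"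
    and scale_add_right: "\<lbrakk>x \<in> vecs K; y \<in> vecs K\<rbrakk>
                      \<Longrightarrow> vscale K c (vadd K x y) = vadd K (vscale K c x) (vscale K c y)"
    and scale_add_left: "x \<in> vecs K
                      \<Longrightarrow> vscale K (c + d) x = vadd K (vscale K c x) (vscale K d x)"
    and scale_scale: "x \<in> vecs K \<Longrightarrow> vscale K c (vscale K d x) = vscale K (c * d) x"
    and scale_one: "x \<in> vecs K \<Longrightarrow> vscale K 1 x = x"

text \<open>
  The norm determines the inner product, so the latter is not part of the structure; in the
  presence of \<open>norm_inner\<close>, the axiom \<open>norm_eq_zero\<close> is positive definiteness.
\<close>

definition norm_from_inner ::
    "('a, 'm) normed_struct_scheme \<Rightarrow> ('a \<Rightarrow> 'a \<Rightarrow> complex) \<Rightarrow> bool" where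
  "norm_from_inner K ip \<longleftrightarrow>
     (\<forall>x\<in>vecs K. \<forall>y\<in>vecs K. \<forall>z\<in>vecs K. ip (vadd K x y) z = ip x z + ip y z) \<and>
     (\<forall>x\<in>vecs K. \<forall>y\<in>vecs K. \<forall>c. ip (vscale K c x) y = c * ip x y) \<and>
     (\<forall>x\<in>vecs K. \<forall>y\<in>vecs K. ip y x = cnj (ip x y)) \<and>
     (\<forall>x\<in>vecs K. ip x x = complex_of_real ((vnorm K x)\<^sup>2))"

locale complex_hilbert_space = complex_vector_space K
  for K :: "('a, 'm) normed_struct_scheme" (structure) +
  assumes norm_nonneg: "x \<in> vecs K \<Longrightarrow> 0 \<le> vnorm K x"
    and norm_eq_zero: "\<lbrakk>x \<in> vecs K; vnorm K x = 0\<rbrakk> \<Longrightarrow> x = vzero K"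
    and norm_inner: "\<exists>ip. norm_from_inner K ip"
    and complete: "\<lbrakk>\<And>n::nat. X n \<in> vecs K;
                    \<And>e. 0 < e \<Longrightarrow> \<exists>N. \<forall>m\<ge>N. \<forall>n\<ge>N. vnorm K (vdiff K (X m) (X n)) < e\<rbrakk>
                   \<Longrightarrow> \<exists>l\<in>vecs K. (\<lambda>n. vnorm K (vdiff K (X n) l)) \<longlonglongrightarrow> 0"


section \<open>Operators\<close>

definition linear_op ::
    "('a, 'm) normed_struct_scheme \<Rightarrow> ('b, 'n) normed_struct_scheme \<Rightarrow> ('a \<Rightarrow> 'b) \<Rightarrow> bool" where
  "linear_op H K S \<longleftrightarrow>
     S \<in> vecs H \<rightarrow> vecs K \<and>
     (\<forall>x\<in>vecs H. \<forall>y\<in>vecs H. S (vadd H x y) = vadd K (S x) (S y)) \<and>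
     (\<forall>x\<in>vecs H. \<forall>c. S (vscale H c x) = vscale K c (S x))"

definition bounded_op ::
    "('a, 'm) normed_struct_scheme \<Rightarrow> ('b, 'n) normed_struct_scheme \<Rightarrow> ('a \<Rightarrow> 'b) \<Rightarrow> bool" where
  "bounded_op H K S \<longleftrightarrow>
     linear_op H K S \<and> (\<exists>B. \<forall>x\<in>vecs H. vnorm K (S x) \<le> B * vnorm H x)"

definition isometry_op :: "('a, 'm) normed_struct_scheme \<Rightarrow> ('a \<Rightarrow> 'a) \<Rightarrow> bool" where
  "isometry_op K V \<longleftrightarrow> linear_op K K V \<and> (\<forall>x\<in>vecs K. vnorm K (V x) = vnorm K x)"

text \<open>
  \<open>R\<close> is the inverse of \<open>S\<close>. The space \<open>K\<close> has its vectors in the same type as \<open>H\<close>. This is no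
  restriction: \<open>S\<close> is a bijection from \<open>vecs H\<close> onto \<open>vecs K\<close>, along which the structure of a
  Hilbert space over any other type can be transported to the set \<open>vecs H\<close>.
\<close>

definition similar_to_isometry :: "'a normed_struct \<Rightarrow> ('a \<Rightarrow> 'a) \<Rightarrow> bool" where
  "similar_to_isometry H T \<longleftrightarrow>
     (\<exists>(K :: 'a normed_struct) S R V.
        complex_hilbert_space K \<and>
        bounded_op H K S \<and> bounded_op K H R \<and>
        (\<forall>x\<in>vecs H. R (S x) = x) \<and> (\<forall>y\<in>vecs K. S (R y) = y) \<and>
        isometry_op K V \<and>
        (\<forall>x\<in>vecs H. T x = R (V (S x))))"


section \<open>The Hardy space of the upper half-plane\<close>

definition upper_half_plane :: "complex set" where
  "upper_half_plane = {z. 0 < Im z}"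

definition hardy_norm_sq :: "(complex \<Rightarrow> complex) \<Rightarrow> ennreal" where
  "hardy_norm_sq u = (SUP y\<in>{0<..}. \<integral>\<^sup>+ x. ennreal ((cmod (u (Complex x y)))\<^sup>2) \<partial>lborel)"

text \<open>
  Functions on the half-plane are represented by total functions that vanish outside it, so that
  equality of vectors is equality of functions on the half-plane.
\<close>

definition hardy_space :: "(complex \<Rightarrow> complex) normed_struct" where
  "hardy_space =
     \<lparr> vecs = {u. u analytic_on upper_half_plane \<and> (\<forall>z. z \<notin> upper_half_plane \<longrightarrow> u z = 0) \<and>
                  hardy_norm_sq u < \<infinity>},
       vzero = (\<lambda>z. 0),
       vadd = (\<lambda>u v z. u z + v z),
       vscale = (\<lambda>c u z. c * u z),
       vnorm = (\<lambda>u. sqrt (enn2real (hardy_norm_sq u))) \<rparr>"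

definition composition_op ::
    "(complex \<Rightarrow> complex) \<Rightarrow> (complex \<Rightarrow> complex) \<Rightarrow> (complex \<Rightarrow> complex)" where
  "composition_op \<phi> u = (\<lambda>z. if z \<in> upper_half_plane then u (\<phi> z) else 0)"

definition nevanlinna_map :: "real \<Rightarrow> real measure \<Rightarrow> complex \<Rightarrow> complex" where
  "nevanlinna_map \<alpha> \<rho> z =
     of_real \<alpha> + z + (\<integral>t. (1 + of_real t * z) / (of_real t - z) \<partial>\<rho>)"

end

theory Submission
  imports Defs
begin

text \<open>
  The example is \<open>\<Phi> z = z + 3 + \<kappa> (Ln (z - 1) - Ln (z + 1))\<close> with \<open>\<kappa> = 2 / ln 3\<close>; in the Nevanlinna
  representation this is \<open>\<alpha> = 3\<close> and \<open>d\<rho> = \<kappa> / (1 + t\<^sup>2) dt\<close> on \<open>[-1, 1]\<close> (\<open>nevanlinna_map_eq\<close>).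
  On the interval \<open>[-1, 1]\<close> the boundary values of \<open>\<Phi>\<close> lie inside the half-plane, and this loss of
  boundary mass keeps \<open>C\<^sub>\<Phi>\<close> from being isometric. Off the interval the boundary values are real, and
  \<open>\<kappa>\<close> is such that \<open>\<Phi>\<close> maps \<open>{x. 2 \<le> \<bar>x\<bar>}\<close> onto the real line, one to one except that \<open>2\<close> and \<open>-2\<close>
  both go to \<open>3\<close>. Every point moves at least one unit to the right under this map, so the
  derivatives, \<open>1 + O(1 / x\<^sup>2)\<close>, have bounded products along orbits. Hence \<open>\<Phi>\<^sup>n\<close> maps Lebesgue
  measure on the set of points with \<open>n\<close> iterates in \<open>{x. 2 \<le> \<bar>x\<bar>}\<close> to a measure on the real line with
  density bounded below by a constant independent of \<open>n\<close>, and \<open>\<parallel>C\<^sub>\<Phi>\<^sup>n u\<parallel> \<ge> c \<parallel>u\<parallel>\<close> follows.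

  The product of derivatives is controlled by a weight \<open>exp (- 10 \<kappa> arctan x)\<close> that decreases along
  orbits faster than the derivatives grow (\<open>weight_boundary_map\<close>, \<open>weighted_transfer_power\<close>).
  No boundary values of general Hardy functions enter: the lower bound is proved for the upward
  translates of \<open>u\<close>, which are continuous up to the real line
  (\<open>C_power_translate_lower_bound\<close>), and these converge to \<open>u\<close> in norm because their norms do not exceed
  that of \<open>u\<close> (\<open>hardy_tendsto_if_pointwise\<close>).

  A contraction whose powers are uniformly bounded below is isometric in the equivalent Hilbert norm
  \<open>lim \<parallel>T\<^sup>n u\<parallel>\<close> (\<open>similar_to_isometry_if_bounded_below\<close>). Contractivity, completeness and the failure
  of isometry all rest on the Poisson formula for bounded holomorphic functions: it bounds
  \<open>|u|\<^sup>2\<close> by a Poisson integral over a lower line (\<open>poisson_submean\<close>), and it bounds the integral of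
  \<open>Im (- 1 / (\<Phi> - c))\<close> over a line by \<open>\<pi>\<close> (\<open>poisson_mass_le_one\<close>).
\<close>

section \<open>Limits of inner products and renorming\<close>

lemma complex_vector_space_change_norm:
  assumes "complex_vector_space K"
  shows "complex_vector_space (K\<lparr>vnorm := p\<rparr>)"
proof -
  have e: "vecs (K\<lparr>vnorm := p\<rparr>) = vecs K" "vzero (K\<lparr>vnorm := p\<rparr>) = vzero K"
    "vadd (K\<lparr>vnorm := p\<rparr>) = vadd K" "vscale (K\<lparr>vnorm := p\<rparr>) = vscale K"
    by simp_all
  show ?thesis using assms unfolding complex_vector_space_def e .
qed

lemma norm_sq_add_scale:
  assumes V: "complex_vector_space K" and ip: "norm_from_inner K ip"
    and x: "x \<in> vecs K" and y: "y \<in> vecs K"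
  shows "of_real ((vnorm K (vadd K x (vscale K c y)))\<^sup>2) =
      ip x x + cnj c * ip x y + c * ip y x + c * cnj c * ip y y"
proof -
  interpret complex_vector_space K by fact
  have add: "ip (vadd K a b) d = ip a d + ip b d" and scale: "ip (vscale K c a) b = c * ip a b"
    and conj: "ip b a = cnj (ip a b)" and sq: "ip a a = of_real ((vnorm K a)\<^sup>2)"
    if "a \<in> vecs K" "b \<in> vecs K" "d \<in> vecs K" for a b c d
    using ip that unfolding norm_from_inner_def by blast+
  let ?w = "vscale K c y"
  have w: "?w \<in> vecs K" using y by (rule scale_closed)
  have s: "vadd K x ?w \<in> vecs K" using x w by (rule add_closed)
  have R: "ip a (vadd K x ?w) = ip a x + cnj c * ip a y" if a: "a \<in> vecs K" for a
  proof -
    have "ip a (vadd K x ?w) = cnj (ip x a + c * ip y a)"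
      using conj[OF s a a] add[OF x w a] scale[OF y a a] by simp
    also have "\<dots> = ip a x + cnj c * ip a y"
      using conj[OF x a a] conj[OF y a a] by simp
    finally show ?thesis .
  qed
  have "of_real ((vnorm K (vadd K x ?w))\<^sup>2) = ip (vadd K x ?w) (vadd K x ?w)"
    using sq[OF s s s] by simp
  also have "\<dots> = ip x (vadd K x ?w) + c * ip y (vadd K x ?w)"
    using add[OF x w s] scale[OF y s s] by simp
  also have "\<dots> = ip x x + cnj c * ip x y + c * ip y x + c * cnj c * ip y y"
    by (simp add: R x y algebra_simps)
  finally show ?thesis .
qed

lemma polarization:
  assumes "complex_vector_space K" "norm_from_inner K ip" "x \<in> vecs K" "y \<in> vecs K"
  shows "ip x y = (\<Sum>c\<in>{1, -1, \<i>, -\<i>}. c * of_real ((vnorm K (vadd K x (vscale K c y)))\<^sup>2)) / 4"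
proof -
  have "\<i> \<noteq> - \<i>" "(1::complex) \<noteq> \<i>" "(1::complex) \<noteq> -\<i>" "-(1::complex) \<noteq> \<i>" "(-1::complex) \<noteq> -\<i>"
    by (auto simp: complex_eq_iff)
  then show ?thesis
    unfolding norm_sq_add_scale[OF assms] by (simp add: algebra_simps)
qed

lemma (in complex_hilbert_space) parallelogram:
  assumes x: "x \<in> vecs K" and y: "y \<in> vecs K"
  shows "(vnorm K (vadd K x y))\<^sup>2 + (vnorm K (vdiff K x y))\<^sup>2 = 2 * (vnorm K x)\<^sup>2 + 2 * (vnorm K y)\<^sup>2"
proof -
  obtain ip where ip: "norm_from_inner K ip" using norm_inner by blast
  have sq: "ip z z = of_real ((vnorm K z)\<^sup>2)" if "z \<in> vecs K" for z
    using ip that unfolding norm_from_inner_def by blast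
  have "complex_of_real ((vnorm K (vadd K x y))\<^sup>2 + (vnorm K (vdiff K x y))\<^sup>2)
      = of_real (2 * (vnorm K x)\<^sup>2 + 2 * (vnorm K y)\<^sup>2)"
    using norm_sq_add_scale[OF complex_vector_space_axioms ip x y, of 1]
      norm_sq_add_scale[OF complex_vector_space_axioms ip x y, of "-1"]
    by (simp add: scale_one y vdiff_def sq x)
  then show ?thesis by (simp only: of_real_eq_iff)
qed

text \<open>
  By polarization an inner product is a fixed combination of squared norms, so pointwise convergence
  of norms makes the inner products converge, and their algebraic laws survive in the limit. This
  serves twice: the Hardy norm is a limit of \<open>L\<^sup>2\<close> norms on horizontal lines, and the norm that makes
  an operator isometric is a limit of norms along its powers.
\<close>

lemma norm_from_inner_limit:
  fixes p :: "nat \<Rightarrow> 'a \<Rightarrow> real"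
  assumes V: "complex_vector_space K"
    and ip: "\<And>i. \<exists>ip. norm_from_inner (K\<lparr>vnorm := p i\<rparr>) ip"
    and lim: "\<And>x. x \<in> vecs K \<Longrightarrow> (\<lambda>i. p i x) \<longlonglongrightarrow> vnorm K x"
  shows "\<exists>ip. norm_from_inner K ip"
proof -
  interpret complex_vector_space K by fact
  from ip obtain q where q: "\<And>i. norm_from_inner (K\<lparr>vnorm := p i\<rparr>) (q i)" by metis
  define L where
    "L x y = (\<Sum>c\<in>{1, -1, \<i>, -\<i>}. c * complex_of_real ((vnorm K (vadd K x (vscale K c y)))\<^sup>2)) / 4" for x y
  have V': "complex_vector_space (K\<lparr>vnorm := p i\<rparr>)" for i
    using V by (rule complex_vector_space_change_norm)
  have tends: "(\<lambda>i. q i x y) \<longlonglongrightarrow> L x y" if x: "x \<in> vecs K" and y: "y \<in> vecs K" for x y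
  proof -
    have "q i x y = (\<Sum>c\<in>{1, -1, \<i>, -\<i>}. c * of_real ((p i (vadd K x (vscale K c y)))\<^sup>2)) / 4" for i
      using polarization[OF V' q, of x i y] x y by simp
    then have "(\<lambda>i. q i x y) = (\<lambda>i. (\<Sum>c\<in>{1, -1, \<i>, -\<i>}.
        c * of_real ((p i (vadd K x (vscale K c y)))\<^sup>2)) / 4)"
      by (rule ext)
    moreover have "(\<lambda>i. (\<Sum>c\<in>{1, -1, \<i>, -\<i>}.
        c * complex_of_real ((p i (vadd K x (vscale K c y)))\<^sup>2)) / 4) \<longlonglongrightarrow> L x y"
      unfolding L_def by (intro tendsto_intros lim add_closed scale_closed x y) simp
    ultimately show ?thesis by (simp only:)
  qed
  have q': "q i (vadd K x y) z = q i x z + q i y z" "q i (vscale K c x) y = c * q i x y"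
    "q i y x = cnj (q i x y)" "q i x x = of_real ((p i x)\<^sup>2)"
    if "x \<in> vecs K" "y \<in> vecs K" "z \<in> vecs K" for i x y z c
  proof -
    have e: "vecs (K\<lparr>vnorm := p i\<rparr>) = vecs K" "vadd (K\<lparr>vnorm := p i\<rparr>) = vadd K"
      "vscale (K\<lparr>vnorm := p i\<rparr>) = vscale K" "vnorm (K\<lparr>vnorm := p i\<rparr>) = p i"
      by simp_all
    note D = q[of i, unfolded norm_from_inner_def e]
    show "q i (vadd K x y) z = q i x z + q i y z" "q i (vscale K c x) y = c * q i x y"
    "q i y x = cnj (q i x y)" "q i x x = of_real ((p i x)\<^sup>2)"
      using D that by blast+
  qed
  have "L (vadd K x y) z = L x z + L y z" if m: "x \<in> vecs K" "y \<in> vecs K" "z \<in> vecs K" for x y z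
  proof (rule LIMSEQ_unique)
    show "(\<lambda>i. q i (vadd K x y) z) \<longlonglongrightarrow> L (vadd K x y) z" using m by (intro tends add_closed)
    show "(\<lambda>i. q i (vadd K x y) z) \<longlonglongrightarrow> L x z + L y z"
      unfolding q'(1)[OF m] using m by (intro tendsto_add tends)
  qed
  moreover have "L (vscale K c x) y = c * L x y" if m: "x \<in> vecs K" "y \<in> vecs K" for x y c
  proof (rule LIMSEQ_unique)
    show "(\<lambda>i. q i (vscale K c x) y) \<longlonglongrightarrow> L (vscale K c x) y" using m by (intro tends scale_closed)
    show "(\<lambda>i. q i (vscale K c x) y) \<longlonglongrightarrow> c * L x y"
      unfolding q'(2)[OF m m(1)] using m by (intro tendsto_mult tends tendsto_const)
  qed
  moreover have "L y x = cnj (L x y)" if m: "x \<in> vecs K" "y \<in> vecs K" for x y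
  proof (rule LIMSEQ_unique)
    show "(\<lambda>i. q i y x) \<longlonglongrightarrow> L y x" using m by (intro tends)
    show "(\<lambda>i. q i y x) \<longlonglongrightarrow> cnj (L x y)"
      unfolding q'(3)[OF m m(1)] using m by (intro tendsto_cnj tends)
  qed
  moreover have "L x x = of_real ((vnorm K x)\<^sup>2)" if m: "x \<in> vecs K" for x
  proof (rule LIMSEQ_unique)
    show "(\<lambda>i. q i x x) \<longlonglongrightarrow> L x x" using m by (intro tends)
    show "(\<lambda>i. q i x x) \<longlonglongrightarrow> of_real ((vnorm K x)\<^sup>2)"
      unfolding q'(4)[OF m m m] using m by (intro tendsto_intros lim)
  qed
  ultimately have "norm_from_inner K L" unfolding norm_from_inner_def by blast
  then show ?thesis by blast
qed

text \<open>
  The norms of \<open>x\<close>, \<open>T x\<close>, \<open>T\<^sup>2 x\<close>, ... decrease, and their limit does not change when the first term is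
  dropped, so \<open>T\<close> is isometric for the limit norm. The bounds \<open>c\<close> and \<open>1\<close> make that norm equivalent to the
  given one, and the identity map intertwines.
\<close>

theorem similar_to_isometry_if_bounded_below:
  fixes H :: "'a normed_struct"
  assumes H: "complex_hilbert_space H" and lin: "linear_op H H T"
    and contr: "\<And>x. x \<in> vecs H \<Longrightarrow> vnorm H (T x) \<le> vnorm H x"
    and c: "0 < c" and below: "\<And>n x. x \<in> vecs H \<Longrightarrow> c * vnorm H x \<le> vnorm H ((T ^^ n) x)"
  shows "similar_to_isometry H T"
proof -
  interpret complex_hilbert_space H by fact
  have T: "T x \<in> vecs H" "T (vadd H x y) = vadd H (T x) (T y)" "T (vscale H a x) = vscale H a (T x)"
    if "x \<in> vecs H" "y \<in> vecs H" for x y a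
    using lin that unfolding linear_op_def by auto
  have Tn: "(T ^^ n) x \<in> vecs H" if "x \<in> vecs H" for n x
    using that by (induction n) (auto intro: T)
  have Tn_add: "(T ^^ n) (vadd H x y) = vadd H ((T ^^ n) x) ((T ^^ n) y)"
    if "x \<in> vecs H" "y \<in> vecs H" for n x y
    using that by (induction n) (auto simp: T Tn)
  have Tn_scale: "(T ^^ n) (vscale H a x) = vscale H a ((T ^^ n) x)" if "x \<in> vecs H" for n x a
    using that by (induction n) (auto simp: T Tn)
  define p where "p n x = vnorm H ((T ^^ n) x)" for n x
  define K where "K = H\<lparr>vnorm := \<lambda>x. lim (\<lambda>n. p n x)\<rparr>"
  have [simp]: "vecs K = vecs H" "vzero K = vzero H" "vadd K = vadd H" "vscale K = vscale H"
    by (simp_all add: K_def)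
  have dec: "decseq (\<lambda>n. p n x)" if "x \<in> vecs H" for x
    unfolding p_def using that by (intro decseq_SucI) (simp add: contr Tn)
  have plim: "(\<lambda>n. p n x) \<longlonglongrightarrow> vnorm K x" if x: "x \<in> vecs H" for x
  proof -
    have "convergent (\<lambda>n. p n x)"
      using decseq_convergent[OF dec[OF x], of 0] by (auto simp: p_def convergent_def norm_nonneg Tn x)
    then show ?thesis by (simp add: K_def convergent_LIMSEQ_iff)
  qed
  have upper: "vnorm K x \<le> vnorm H x" if x: "x \<in> vecs H" for x
    using decseq_ge[OF dec[OF x] plim[OF x], of 0] by (simp add: p_def)
  have lower: "c * vnorm H x \<le> vnorm K x" if x: "x \<in> vecs H" for x
    by (rule LIMSEQ_le_const[OF plim[OF x]]) (use below[OF x] in \<open>auto simp: p_def\<close>)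
  have VK: "complex_vector_space K"
    unfolding K_def using complex_vector_space_axioms by (rule complex_vector_space_change_norm)
  have ipK: "\<exists>ip. norm_from_inner K ip"
  proof (rule norm_from_inner_limit[OF VK])
    fix n
    let ?K = "K\<lparr>vnorm := p n\<rparr>"
    have K_simps: "vecs ?K = vecs H" "vadd ?K = vadd H" "vscale ?K = vscale H" "vnorm ?K = p n"
      by simp_all
    obtain ip where ip: "norm_from_inner H ip" using norm_inner by blast
    have "norm_from_inner (K\<lparr>vnorm := p n\<rparr>) (\<lambda>x y. ip ((T ^^ n) x) ((T ^^ n) y))"
      unfolding norm_from_inner_def K_simps
    proof (intro conjI ballI allI)
      fix x y z a assume m: "x \<in> vecs H" "y \<in> vecs H" "z \<in> vecs H"
      show "ip ((T ^^ n) (vadd H x y)) ((T ^^ n) z) = ip ((T ^^ n) x) ((T ^^ n) z) + ip ((T ^^ n) y) ((T ^^ n) z)"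
        unfolding Tn_add[OF m(1,2)] using ip m Tn unfolding norm_from_inner_def by blast
    next
      fix x y a assume m: "x \<in> vecs H" "y \<in> vecs H"
      show "ip ((T ^^ n) (vscale H a x)) ((T ^^ n) y) = a * ip ((T ^^ n) x) ((T ^^ n) y)"
        unfolding Tn_scale[OF m(1)] using ip m Tn unfolding norm_from_inner_def by blast
      show "ip ((T ^^ n) y) ((T ^^ n) x) = cnj (ip ((T ^^ n) x) ((T ^^ n) y))"
        using ip Tn[OF m(1)] Tn[OF m(2)] unfolding norm_from_inner_def by blast
    next
      fix x assume m: "x \<in> vecs H"
      show "ip ((T ^^ n) x) ((T ^^ n) x) = complex_of_real ((p n x)\<^sup>2)"
        unfolding p_def using ip m Tn unfolding norm_from_inner_def by blast
    qed
    then show "\<exists>ip. norm_from_inner (K\<lparr>vnorm := p n\<rparr>) ip" by blast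
  qed (use plim in simp)
  have diff: "vdiff K x y = vdiff H x y" for x y by (simp add: vdiff_def)
  have diff_in: "vdiff H x y \<in> vecs H" if "x \<in> vecs H" "y \<in> vecs H" for x y
    unfolding vdiff_def using that by (intro add_closed scale_closed)
  have HK: "complex_hilbert_space K"
  proof (intro complex_hilbert_space.intro VK complex_hilbert_space_axioms.intro)
    fix x assume x: "x \<in> vecs K"
    have "0 \<le> c * vnorm H x" using c norm_nonneg x by simp
    then show "0 \<le> vnorm K x" using lower[of x] x by simp
    assume "vnorm K x = 0"
    then have "c * vnorm H x \<le> 0" using lower[of x] x by simp
    then have "vnorm H x = 0" using c norm_nonneg[of x] x by (simp add: mult_le_0_iff)
    then show "x = vzero K" using norm_eq_zero x by simp
  next
    show "\<exists>ip. norm_from_inner K ip" by (rule ipK)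
  next
    fix X :: "nat \<Rightarrow> 'a"
    assume X: "\<And>n. X n \<in> vecs K"
      and cauchy: "\<And>e. 0 < e \<Longrightarrow> \<exists>N. \<forall>m\<ge>N. \<forall>n\<ge>N. vnorm K (vdiff K (X m) (X n)) < e"
    have "\<exists>N. \<forall>m\<ge>N. \<forall>n\<ge>N. vnorm H (vdiff H (X m) (X n)) < e" if "0 < e" for e
    proof -
      obtain N where N: "\<forall>m\<ge>N. \<forall>n\<ge>N. vnorm K (vdiff K (X m) (X n)) < c * e"
        using cauchy[of "c * e"] mult_pos_pos[OF c \<open>0 < e\<close>] by blast
      have "vnorm H (vdiff H (X m) (X n)) < e" if "m \<ge> N" "n \<ge> N" for m n
      proof -
        have "c * vnorm H (vdiff H (X m) (X n)) < c * e"
          using lower[OF diff_in, of "X m" "X n"] X N that by (fastforce simp: diff)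
        then show ?thesis using c by simp
      qed
      then show ?thesis by blast
    qed
    then obtain l where l: "l \<in> vecs H" "(\<lambda>n. vnorm H (vdiff H (X n) l)) \<longlonglongrightarrow> 0"
      using complete[of X] X by auto
    have "(\<lambda>n. vnorm K (vdiff K (X n) l)) \<longlonglongrightarrow> 0"
    proof (rule tendsto_sandwich[OF _ _ tendsto_const l(2)])
      show "\<forall>\<^sub>F n in sequentially. 0 \<le> vnorm K (vdiff K (X n) l)"
      proof (intro always_eventually allI)
        fix n
        have d: "vdiff H (X n) l \<in> vecs H" using X l by (simp add: diff_in)
        have "0 \<le> c * vnorm H (vdiff H (X n) l)" using c norm_nonneg[OF d] by simp
        then show "0 \<le> vnorm K (vdiff K (X n) l)" using lower[OF d] by (simp add: diff)
      qed
      show "\<forall>\<^sub>F n in sequentially. vnorm K (vdiff K (X n) l) \<le> vnorm H (vdiff H (X n) l)"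
        using X l by (intro always_eventually allI) (simp add: diff upper diff_in)
    qed
    then show "\<exists>l\<in>vecs K. (\<lambda>n. vnorm K (vdiff K (X n) l)) \<longlonglongrightarrow> 0" using l by auto
  qed
  have SK: "bounded_op H K id"
    unfolding bounded_op_def linear_op_def by (auto intro!: exI[of _ 1] upper)
  have RK: "bounded_op K H id"
    unfolding bounded_op_def linear_op_def
    using lower c by (auto intro!: exI[of _ "1 / c"] simp: field_simps)
  have iso: "isometry_op K T"
    unfolding isometry_op_def
  proof (intro conjI ballI)
    show "linear_op K K T" using lin by (simp add: linear_op_def)
    fix x assume "x \<in> vecs K"
    then have x: "x \<in> vecs H" by simp
    have "(\<lambda>n. p (Suc n) x) \<longlonglongrightarrow> vnorm K x" using plim[OF x] by (rule LIMSEQ_Suc)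
    moreover have "p (Suc n) x = p n (T x)" for n by (simp add: p_def funpow_Suc_right del: funpow.simps)
    ultimately show "vnorm K (T x) = vnorm K x"
      using LIMSEQ_unique plim T(1)[OF x x] by fastforce
  qed
  show ?thesis
    unfolding similar_to_isometry_def
    by (rule exI[of _ K], rule exI[of _ id], rule exI[of _ id], rule exI[of _ T]) (use HK SK RK iso in simp)
qed

section \<open>The Poisson formula on the half-plane\<close>

definition poisson_kernel :: "complex \<Rightarrow> real \<Rightarrow> real" where
  "poisson_kernel w t = Im w / (pi * (cmod (of_real t - w))\<^sup>2)"

lemma cmod_real_minus_sq: "(cmod (of_real t - w))\<^sup>2 = (t - Re w)\<^sup>2 + (Im w)\<^sup>2"
  by (simp add: cmod_power2)

lemma poisson_kernel_nonneg: "0 \<le> Im w \<Longrightarrow> 0 \<le> poisson_kernel w t"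
  by (simp add: poisson_kernel_def)

lemma poisson_kernel_le: "0 < Im w \<Longrightarrow> poisson_kernel w t \<le> 1 / (pi * Im w)"
proof -
  assume w: "0 < Im w"
  have "poisson_kernel w t \<le> Im w / (pi * (Im w)\<^sup>2)"
    unfolding poisson_kernel_def cmod_real_minus_sq using w
    by (intro divide_left_mono mult_left_mono mult_pos_pos) (auto intro: add_nonneg_pos)
  then show ?thesis using w by (simp add: power2_eq_square)
qed

lemma poisson_kernel_measurable [measurable]:
  "(\<lambda>t. poisson_kernel w t) \<in> borel_measurable borel"
  unfolding poisson_kernel_def cmod_real_minus_sq by measurable

lemma has_bochner_integral_poisson_kernel:
  assumes w: "0 < Im w"
  shows "has_bochner_integral lborel (poisson_kernel w) 1"
proof -
  have "has_bochner_integral lborel (\<lambda>x. inverse (1 + x\<^sup>2)) pi"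
    using integrable_inverse_1_plus_square LBINT_inverse_1_plus_square
    by (simp add: has_bochner_integral_iff set_integrable_def interval_lebesgue_integral_def set_lebesgue_integral_def)
  then have "has_bochner_integral lborel (\<lambda>x. inverse (pi * Im w) * inverse (1 + x\<^sup>2)) (inverse (pi * Im w) * pi)"
    by (intro has_bochner_integral_mult_right) auto
  moreover have "poisson_kernel w (Re w + Im w * x) = inverse (pi * Im w) * inverse (1 + x\<^sup>2)" for x
  proof -
    have "(Re w + Im w * x - Re w)\<^sup>2 + (Im w)\<^sup>2 = (Im w)\<^sup>2 * (1 + x\<^sup>2)"
      by (simp add: power_mult_distrib distrib_left)
    then show ?thesis
      using w unfolding poisson_kernel_def cmod_real_minus_sq
      by (simp add: power2_eq_square inverse_eq_divide)
  qed
  ultimately have "has_bochner_integral lborel (\<lambda>x. poisson_kernel w (Re w + Im w * x)) (1 /\<^sub>R \<bar>Im w\<bar>)"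
    using w by (simp add: field_simps)
  then show ?thesis
    using w by (subst lborel_has_bochner_integral_real_affine_iff[of "Im w" _ _ "Re w"]) auto
qed

text \<open>
  A primitive \<open>Q\<close> of \<open>q\<close> replaces contour integration: \<open>Q R - Q (-R)\<close> is the sum of the increments of \<open>Q\<close>
  along the three other sides of the rectangle with corners \<open>\<plusminus>R\<close> and \<open>\<plusminus>R + \<i>R\<close>, where \<open>q\<close> is \<open>O(1 / R\<^sup>2)\<close>
  and the lengths are \<open>O(R)\<close>.
\<close>

lemma real_line_integral_eq_zero:
  assumes \<eta>: "0 < \<eta>" and q_hol: "q holomorphic_on {z. -\<eta> < Im z}"
    and decay: "\<And>z. R0 < cmod z \<Longrightarrow> 0 \<le> Im z \<Longrightarrow> cmod (q z) \<le> C / (cmod z)\<^sup>2"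
    and q_int: "integrable lborel (\<lambda>t. q (of_real t))"
  shows "(\<integral>t. q (of_real t) \<partial>lborel) = 0"
proof -
  define S where "S = {z. - \<eta> < Im z}"
  have S: "convex S" "open S"
    unfolding S_def by (auto intro: convex_halfspace_Im_gt open_halfspace_Im_gt)
  have realS: "of_real t \<in> S" for t using \<eta> by (simp add: S_def)
  have q_hol: "q holomorphic_on S" using q_hol by (simp add: S_def)
  obtain Q where Q_within: "\<And>z. z \<in> S \<Longrightarrow> (Q has_field_derivative q z) (at z within S)"
    by (rule holomorphic_convex_primitive'[OF S q_hol]) (rule that)
  have Q: "(Q has_field_derivative q z) (at z)" if "z \<in> S" for z
    using Q_within[OF that] unfolding at_within_open[OF that S(2)] .
  have bound: "cmod (Q (of_real R) - Q (of_real (- R))) \<le> 4 * C / R" if R: "R0 < R" "0 < R" for R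
  proof -
    have C0: "0 \<le> C"
    proof -
      have "0 \<le> C / (cmod (of_real R))\<^sup>2"
        using order_trans[OF norm_ge_zero decay[of "of_real R"]] R by simp
      then show ?thesis using R by (simp add: zero_le_divide_iff)
    qed
    have step: "cmod (Q a - Q b) \<le> C / R\<^sup>2 * cmod (a - b)"
      if D: "convex D" "a \<in> D" "b \<in> D" "\<And>z. z \<in> D \<Longrightarrow> R \<le> cmod z \<and> 0 \<le> Im z" for D a b
    proof (rule field_differentiable_bound[OF D(1)])
      show "(Q has_field_derivative q z) (at z within D)" if "z \<in> D" for z
        using D(4)[OF that] \<eta> by (intro has_field_derivative_at_within[OF Q]) (simp add: S_def)
      show "cmod (q z) \<le> C / R\<^sup>2" if "z \<in> D" for z
      proof -
        have z: "R \<le> cmod z" "0 \<le> Im z" using D(4)[OF that] by auto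
        have "cmod (q z) \<le> C / (cmod z)\<^sup>2" using z R by (intro decay) auto
        also have "\<dots> \<le> C / R\<^sup>2"
          using z R C0 by (intro divide_left_mono power_mono mult_pos_pos zero_less_power) auto
        finally show ?thesis .
      qed
    qed (rule D)+
    have sides: "convex ({z. R \<le> Re z} \<inter> {z. 0 \<le> Im z})" "convex {z. R \<le> Im z}"
      "convex ({z. Re z \<le> - R} \<inter> {z. 0 \<le> Im z})"
      by (intro convex_Int convex_halfspace_Re_ge convex_halfspace_Im_ge convex_halfspace_Re_le)+
    have far: "R \<le> cmod z" if "R \<le> \<bar>Re z\<bar> \<or> R \<le> \<bar>Im z\<bar>" for z
      using that abs_Re_le_cmod[of z] abs_Im_le_cmod[of z] by linarith
    have len1: "cmod (of_real R - Complex R R) = R"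
      using R(2) by (simp add: cmod_def)
    have len2: "cmod (Complex R R - Complex (-R) R) = 2 * R"
    proof -
      have "Complex R R - Complex (-R) R = of_real (2 * R)" by (simp add: complex_eq_iff)
      then show ?thesis using R(2) by (simp only: norm_of_real)
    qed
    have len3: "cmod (Complex (-R) R - of_real (-R)) = R"
      using R(2) by (simp add: cmod_def)
    have "cmod (Q (of_real R) - Q (Complex R R)) \<le> C / R\<^sup>2 * cmod (of_real R - Complex R R)"
      by (rule step[OF sides(1)]) (use R(2) in \<open>auto intro: far\<close>)
    then have "cmod (Q (of_real R) - Q (Complex R R)) \<le> C / R\<^sup>2 * R"
      unfolding len1 .
    moreover have "cmod (Q (Complex R R) - Q (Complex (-R) R)) \<le> C / R\<^sup>2 * cmod (Complex R R - Complex (-R) R)"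
      by (rule step[OF sides(2)]) (use R(2) in \<open>auto intro: far\<close>)
    then have "cmod (Q (Complex R R) - Q (Complex (-R) R)) \<le> C / R\<^sup>2 * (2 * R)"
      unfolding len2 .
    moreover have "cmod (Q (Complex (-R) R) - Q (of_real (-R))) \<le> C / R\<^sup>2 * cmod (Complex (-R) R - of_real (-R))"
      by (rule step[OF sides(3)]) (use R(2) in \<open>auto intro: far\<close>)
    then have "cmod (Q (Complex (-R) R) - Q (of_real (-R))) \<le> C / R\<^sup>2 * R"
      unfolding len3 .
    moreover have "C / R\<^sup>2 * R = C / R" "C / R\<^sup>2 * (2 * R) = 2 * C / R"
      using R(2) by (simp_all add: power2_eq_square)
    moreover have "cmod (Q (of_real R) - Q (of_real (- R))) \<le> cmod (Q (of_real R) - Q (Complex R R)) +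
      cmod (Q (Complex R R) - Q (Complex (-R) R)) + cmod (Q (Complex (-R) R) - Q (of_real (-R)))"
      using norm_triangle_ineq[of "Q (of_real R) - Q (Complex R R)" "Q (Complex R R) - Q (Complex (-R) R)"]
        norm_triangle_ineq[of "Q (of_real R) - Q (Complex (-R) R)" "Q (Complex (-R) R) - Q (of_real (-R))"]
      by simp
    ultimately have "cmod (Q (of_real R) - Q (of_real (- R))) \<le> C / R + 2 * C / R + C / R"
      by linarith
    then show ?thesis by (simp add: add_divide_distrib[symmetric])
  qed
  have q_cont: "continuous_on UNIV (\<lambda>t. q (of_real t))"
    by (intro continuous_on_compose2[OF holomorphic_on_imp_continuous_on[OF q_hol]] continuous_intros)
      (use realS in auto)
  then have q_meas [measurable]: "(\<lambda>t. q (of_real t)) \<in> borel_measurable borel"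
    by (rule borel_measurable_continuous_onI)
  have "(\<lambda>n. \<integral>t. indicator {- real n..real n} t *\<^sub>R q (of_real t) \<partial>lborel) \<longlonglongrightarrow> (\<integral>t. q (of_real t) \<partial>lborel)"
  proof (rule integral_dominated_convergence)
    show "integrable lborel (\<lambda>t. cmod (q (of_real t)))" using q_int by simp
    show "AE t in lborel. (\<lambda>n. indicator {- real n..real n} t *\<^sub>R q (of_real t)) \<longlonglongrightarrow> q (of_real t)"
    proof (intro AE_I2 tendsto_eventually)
      fix t :: real
      obtain N where N: "\<bar>t\<bar> \<le> real N" using real_arch_simple by blast
      have "indicator {- real n..real n} t *\<^sub>R q (of_real t) = q (of_real t)" if "N \<le> n" for n
      proof -
        have "t \<in> {- real n..real n}" using N that by auto
        then show ?thesis by simp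
      qed
      then show "\<forall>\<^sub>F n in sequentially. indicator {- real n..real n} t *\<^sub>R q (of_real t) = q (of_real t)"
        unfolding eventually_sequentially by blast
    qed
    show "(\<lambda>t. indicator {- real n..real n} t *\<^sub>R q (of_real t)) \<in> borel_measurable lborel" for n
      by measurable
    show "AE t in lborel. norm (indicator {- real n..real n} t *\<^sub>R q (of_real t)) \<le> cmod (q (of_real t))" for n
      by (intro AE_I2) (simp add: indicator_def)
  qed simp
  moreover have "(\<integral>t. indicator {- real n..real n} t *\<^sub>R q (of_real t) \<partial>lborel)
      = Q (of_real (real n)) - Q (of_real (- real n))" for n
  proof -
    have "has_bochner_integral lborel (\<lambda>t. indicator {- real n..real n} t *\<^sub>R q (of_real t))
        (Q (of_real (real n)) - Q (of_real (- real n)))"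
    proof (rule has_bochner_integral_FTC_Icc)
      show "((\<lambda>t. Q (of_real t)) has_vector_derivative q (of_real t)) (at t within {- real n..real n})" for t
        by (rule has_vector_derivative_real_field[OF Q[OF realS]])
      show "continuous_on {- real n..real n} (\<lambda>t. q (of_real t))"
        using q_cont by (rule continuous_on_subset) auto
    qed simp
    then show ?thesis by (rule has_bochner_integral_integral_eq)
  qed
  moreover have "(\<lambda>n. Q (of_real (real n)) - Q (of_real (- real n))) \<longlonglongrightarrow> 0"
  proof (rule Lim_null_comparison)
    have "\<forall>\<^sub>F n in sequentially. max R0 0 < real n"
      using filterlim_real_sequentially unfolding filterlim_at_top_dense by blast
    then show "\<forall>\<^sub>F n in sequentially. cmod (Q (of_real (real n)) - Q (of_real (- real n))) \<le> 4 * C / real n"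
      by eventually_elim (rule bound; simp)
    show "(\<lambda>n. 4 * C / real n) \<longlonglongrightarrow> 0" by (rule lim_const_over_n)
  qed
  ultimately show ?thesis by (simp only: LIMSEQ_unique)
qed

lemma cmod_ge_half:
  assumes "2 * cmod w \<le> R" "R \<le> cmod z"
  shows "R / 2 \<le> cmod (z - w)"
  using norm_triangle_ineq2[of z w] assms by linarith

text \<open>
  The quotient \<open>(f z - f w) / ((z - w) (z - cnj w))\<close> has a removable singularity at \<open>w\<close> and decays like
  \<open>1 / |z|\<^sup>2\<close>, so its integral over the real line vanishes; on that line its denominator is
  \<open>|t - w|\<^sup>2\<close>. Subtracting \<open>f w\<close> in this way avoids residues and winding numbers.
\<close>

lemma poisson_formula:
  assumes \<eta>: "0 < \<eta>" and f: "f holomorphic_on {z. -\<eta> < Im z}"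
    and M: "\<And>z. 0 \<le> Im z \<Longrightarrow> cmod (f z) \<le> M" and w: "0 < Im w"
  shows "has_bochner_integral lborel (\<lambda>t. of_real (poisson_kernel w t) * f (of_real t)) (f w)"
proof -
  \<comment> \<open>The second bound keeps the pole \<open>cnj w\<close> outside.\<close>
  define S where "S = {z. - min \<eta> (Im w) < Im z}"
  have S: "convex S" "open S"
    unfolding S_def by (auto intro: convex_halfspace_Im_gt open_halfspace_Im_gt)
  have M0: "0 \<le> M" using M[of w] w norm_ge_zero[of "f w"] by linarith
  have wS: "w \<in> S" using w \<eta> by (simp add: S_def)
  define q where "q z = (if z = w then deriv f w else (f z - f w) / (z - w)) / (z - cnj w)" for z
  have "f holomorphic_on S" using f by (rule holomorphic_on_subset) (auto simp: S_def)
  then have "(\<lambda>z. if z = w then deriv f w else (f z - f w) / (z - w)) holomorphic_on S"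
    by (rule pole_lemma) (use wS S in \<open>simp add: interior_open\<close>)
  then have q_hol: "q holomorphic_on S"
    unfolding q_def by (rule holomorphic_on_divide) (auto simp: S_def intro!: holomorphic_intros)
  have realS: "of_real t \<in> S" for t using w \<eta> by (simp add: S_def)
  have q_real: "q (of_real t) = (f (of_real t) - f w) / of_real ((cmod (of_real t - w))\<^sup>2)" for t
  proof -
    have "of_real t \<noteq> w" using w by auto
    moreover have "of_real ((cmod (of_real t - w))\<^sup>2) = (of_real t - w) * (of_real t - cnj w)"
      by (simp add: complex_norm_square del: of_real_power)
    ultimately show ?thesis by (simp add: q_def)
  qed
  have decay: "cmod (q z) \<le> 8 * M / (cmod z)\<^sup>2" if R: "2 * cmod w < cmod z" "0 \<le> Im z" for z
  proof -
    have z0: "0 < cmod z" using R(1) norm_ge_zero[of w] by linarith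
    have "z \<noteq> w" using R(1) norm_ge_zero[of w] by force
    then have "cmod (q z) = cmod (f z - f w) / (cmod (z - w) * cmod (z - cnj w))"
      by (simp add: q_def norm_divide norm_mult)
    also have "\<dots> \<le> (2 * M) / (cmod z / 2 * (cmod z / 2))"
    proof (intro frac_le mult_mono)
      show "cmod (f z - f w) \<le> 2 * M"
        using norm_triangle_ineq4[of "f z" "f w"] M[of z] M[of w] R w by linarith
      show "cmod z / 2 \<le> cmod (z - w)" "cmod z / 2 \<le> cmod (z - cnj w)"
        using cmod_ge_half[of w "cmod z" z] cmod_ge_half[of "cnj w" "cmod z" z] R by simp_all
    qed (use z0 M0 in auto)
    finally show ?thesis by (simp add: power2_eq_square)
  qed
  have q_cont: "continuous_on UNIV (\<lambda>t. q (of_real t))"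
    by (intro continuous_on_compose2[OF holomorphic_on_imp_continuous_on[OF q_hol]] continuous_intros)
      (use realS in auto)
  then have q_meas [measurable]: "(\<lambda>t. q (of_real t)) \<in> borel_measurable borel"
    by (rule borel_measurable_continuous_onI)
  note P = has_bochner_integral_poisson_kernel[OF w]
  have q_int: "integrable lborel (\<lambda>t. q (of_real t))"
  proof (rule Bochner_Integration.integrable_bound)
    show "integrable lborel (\<lambda>t. 2 * M * pi / Im w * poisson_kernel w t)"
      using P by (intro integrable_mult_right) (auto simp: has_bochner_integral_iff)
    have "cmod (f (of_real t) - f w) \<le> 2 * M" for t
      using norm_triangle_ineq4[of "f (of_real t)" "f w"] M[of "of_real t"] M[of w] w by simp
    then show "AE t in lborel. cmod (q (of_real t)) \<le> norm (2 * M * pi / Im w * poisson_kernel w t)"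
      using w M0 by (intro AE_I2)
       (simp add: q_real poisson_kernel_def norm_divide abs_mult divide_right_mono del: of_real_power)
  qed simp
  have "(\<integral>t. q (of_real t) \<partial>lborel) = 0"
    by (rule real_line_integral_eq_zero[OF _ q_hol[unfolded S_def] decay q_int]) (use \<eta> w in auto)
  then have "has_bochner_integral lborel (\<lambda>t. q (of_real t)) 0"
    using q_int by (simp add: has_bochner_integral_iff)
  then have "has_bochner_integral lborel (\<lambda>t. of_real (Im w / pi) * q (of_real t)) (of_real (Im w / pi) * 0)"
    by (intro has_bochner_integral_mult_right) auto
  moreover have "has_bochner_integral lborel (\<lambda>t. of_real (poisson_kernel w t) * f w) (of_real 1 * f w)"
    using P by (intro has_bochner_integral_mult_left has_bochner_integral_of_real)
  ultimately have "has_bochner_integral lborel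
    (\<lambda>t. of_real (Im w / pi) * q (of_real t) + of_real (poisson_kernel w t) * f w)
    (of_real (Im w / pi) * 0 + of_real 1 * f w)"
    by (rule has_bochner_integral_add)
  moreover have "of_real (Im w / pi) * q (of_real t) + of_real (poisson_kernel w t) * f w
    = of_real (poisson_kernel w t) * f (of_real t)" for t
  proof -
    have "cmod (of_real t - w) \<noteq> 0" using w by auto
    then show ?thesis unfolding q_real poisson_kernel_def by (simp add: field_simps)
  qed
  ultimately show ?thesis by simp
qed

section \<open>Point evaluation on the Hardy space\<close>

definition line_norm_sq :: "(complex \<Rightarrow> complex) \<Rightarrow> real \<Rightarrow> ennreal" where
  "line_norm_sq u y = (\<integral>\<^sup>+ x. ennreal ((cmod (u (Complex x y)))\<^sup>2) \<partial>lborel)"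

lemma hardy_norm_sq_eq: "hardy_norm_sq u = (SUP y\<in>{0<..}. line_norm_sq u y)"
  by (simp add: hardy_norm_sq_def line_norm_sq_def)

lemma line_norm_sq_le: "0 < y \<Longrightarrow> line_norm_sq u y \<le> hardy_norm_sq u"
  unfolding hardy_norm_sq_eq by (rule SUP_upper) simp

lemma convex_upper_half_plane: "convex upper_half_plane"
  and open_upper_half_plane: "open upper_half_plane"
  unfolding upper_half_plane_def by (rule convex_halfspace_Im_gt, rule open_halfspace_Im_gt)

lemma measurable_Complex [measurable (raw)]:
  "f \<in> borel_measurable M \<Longrightarrow> g \<in> borel_measurable M \<Longrightarrow> (\<lambda>x. Complex (f x) (g x)) \<in> borel_measurable M"
  by (rule borel_measurable_continuous_Pair) (auto intro!: continuous_intros)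

lemma hardy_iff:
  "u \<in> vecs hardy_space \<longleftrightarrow>
     u holomorphic_on upper_half_plane \<and> (\<forall>z. z \<notin> upper_half_plane \<longrightarrow> u z = 0) \<and> hardy_norm_sq u < \<infinity>"
  by (simp add: hardy_space_def analytic_on_open open_upper_half_plane)

lemma hardy_measurable [measurable_dest]:
  assumes "u \<in> vecs hardy_space"
  shows "u \<in> borel_measurable borel"
proof -
  have u: "u holomorphic_on upper_half_plane" "\<And>z. z \<notin> upper_half_plane \<Longrightarrow> u z = 0"
    using assms by (simp_all add: hardy_iff)
  have "(\<lambda>z. indicator upper_half_plane z *\<^sub>R u z) \<in> borel_measurable borel"
    using open_upper_half_plane holomorphic_on_imp_continuous_on[OF u(1)]
    by (intro borel_measurable_continuous_on_indicator) auto
  moreover have "(\<lambda>z. indicator upper_half_plane z *\<^sub>R u z) = u"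
    by (rule ext) (simp add: indicator_def u(2))
  ultimately show ?thesis by simp
qed

text \<open>
  Poisson's formula for \<open>f\<^sup>2\<close>, which is again bounded and holomorphic.
\<close>

lemma poisson_submean:
  assumes \<eta>: "0 < \<eta>" and f: "f holomorphic_on {z. -\<eta> < Im z}"
    and M: "\<And>z. 0 \<le> Im z \<Longrightarrow> cmod (f z) \<le> M" and w: "0 < Im w"
  shows "ennreal ((cmod (f w))\<^sup>2) \<le> (\<integral>\<^sup>+ t. ennreal (poisson_kernel w t) * ennreal ((cmod (f (of_real t)))\<^sup>2) \<partial>lborel)"
proof -
  have B: "has_bochner_integral lborel (\<lambda>t. of_real (poisson_kernel w t) * (f (of_real t))\<^sup>2) ((f w)\<^sup>2)"
  proof (rule poisson_formula[OF \<eta> _ _ w, where f = "\<lambda>z. (f z)\<^sup>2"])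
    show "(\<lambda>z. (f z)\<^sup>2) holomorphic_on {z. -\<eta> < Im z}" by (intro holomorphic_intros f)
    show "cmod ((f z)\<^sup>2) \<le> M\<^sup>2" if "0 \<le> Im z" for z
      unfolding norm_power by (intro power_mono M that) simp
  qed
  have "ennreal (cmod ((f w)\<^sup>2)) \<le> (\<integral>\<^sup>+ t. ennreal (cmod (of_real (poisson_kernel w t) * (f (of_real t))\<^sup>2)) \<partial>lborel)"
    using B by (rule has_bochner_integral_norm_bound)
  also have "\<dots> = (\<integral>\<^sup>+ t. ennreal (poisson_kernel w t) * ennreal ((cmod (f (of_real t)))\<^sup>2) \<partial>lborel)"
    using w by (intro nn_integral_cong) (simp add: norm_mult norm_power ennreal_mult poisson_kernel_nonneg)
  finally show ?thesis by (simp add: norm_power)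
qed

text \<open>
  Cauchy-Schwarz on a horizontal segment of length \<open>a\<close>. Together with \<open>line_norm_sq_le\<close> it makes horizontal
  averages of a Hardy function bounded on the whole half-plane.
\<close>

lemma primitive_increment_bound:
  assumes F: "\<And>z. z \<in> upper_half_plane \<Longrightarrow> (F has_field_derivative u z) (at z)"
    and u: "continuous_on upper_half_plane u" and z: "0 < Im z" and a: "0 < a"
  shows "ennreal ((cmod (F (z + of_real a) - F z))\<^sup>2)
      \<le> ennreal a * (\<integral>\<^sup>+ s. indicator {0..a} s * ennreal ((cmod (u (z + of_real s)))\<^sup>2) \<partial>lborel)"
proof -
  have zs: "z + of_real s \<in> upper_half_plane" for s using z by (simp add: upper_half_plane_def)
  have cont: "continuous_on UNIV (\<lambda>s. u (z + of_real s))"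
    by (intro continuous_on_compose2[OF u] continuous_intros) (use zs in auto)
  then have [measurable]: "(\<lambda>s. u (z + of_real s)) \<in> borel_measurable borel"
    by (rule borel_measurable_continuous_onI)
  have "has_bochner_integral lborel (\<lambda>s. indicator {0..a} s *\<^sub>R u (z + of_real s)) (F (z + of_real a) - F (z + of_real 0))"
  proof (rule has_bochner_integral_FTC_Icc)
    fix s
    have "((\<lambda>w. F (z + w)) has_field_derivative u (z + of_real s)) (at (of_real s))"
      using F[OF zs[of s]] unfolding add.commute[of z] by (rule DERIV_shift[THEN iffD1])
    then show "((\<lambda>s. F (z + of_real s)) has_vector_derivative u (z + of_real s)) (at s within {0..a})"
      by (rule has_vector_derivative_real_field)
    show "continuous_on {0..a} (\<lambda>s. u (z + of_real s))"
      using cont by (rule continuous_on_subset) simp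
  qed (use a in simp)
  then have "ennreal (cmod (F (z + of_real a) - F (z + of_real 0)))
      \<le> (\<integral>\<^sup>+ s. ennreal (norm (indicator {0..a} s *\<^sub>R u (z + of_real s))) \<partial>lborel)"
    by (rule has_bochner_integral_norm_bound)
  also have "\<dots> = (\<integral>\<^sup>+ s. indicator {0..a} s * (indicator {0..a} s * ennreal (cmod (u (z + of_real s)))) \<partial>lborel)"
    by (intro nn_integral_cong) (auto split: split_indicator)
  finally have "(ennreal (cmod (F (z + of_real a) - F (z + of_real 0))))\<^sup>2
      \<le> (\<integral>\<^sup>+ s. indicator {0..a} s * (indicator {0..a} s * ennreal (cmod (u (z + of_real s)))) \<partial>lborel)\<^sup>2"
    by (intro power_mono) auto
  also have "\<dots> \<le> (\<integral>\<^sup>+ s. (indicator {0..a} s)\<^sup>2 \<partial>lborel) *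
      (\<integral>\<^sup>+ s. (indicator {0..a} s * ennreal (cmod (u (z + of_real s))))\<^sup>2 \<partial>lborel)"
    by (rule Cauchy_Schwarz_nn_integral) measurable
  also have "(\<integral>\<^sup>+ s. (indicator {0..a} s)\<^sup>2 \<partial>lborel) = (\<integral>\<^sup>+ s. indicator {0..a} s \<partial>lborel)"
    by (intro nn_integral_cong) (auto split: split_indicator)
  also have "\<dots> = ennreal a" using a by simp
  also have "(\<integral>\<^sup>+ s. (indicator {0..a} s * ennreal (cmod (u (z + of_real s))))\<^sup>2 \<partial>lborel) =
      (\<integral>\<^sup>+ s. indicator {0..a} s * ennreal ((cmod (u (z + of_real s)))\<^sup>2) \<partial>lborel)"
    by (intro nn_integral_cong) (auto split: split_indicator simp: ennreal_power)
  finally show ?thesis by (simp add: ennreal_power)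
qed

lemma nn_integral_shift:
  fixes f :: "real \<Rightarrow> ennreal"
  assumes [measurable]: "f \<in> borel_measurable borel"
  shows "(\<integral>\<^sup>+ t. f (t + s) \<partial>lborel) = (\<integral>\<^sup>+ t. f t \<partial>lborel)"
  using nn_integral_real_affine[of f 1 s] by (simp add: add.commute)

text \<open>
  Finite norm does not by itself make \<open>u\<close> bounded on smaller half-planes, which Poisson's formula
  requires. The averages \<open>A a z\<close> of \<open>u\<close> over the segments from \<open>z\<close> to \<open>z + a\<close> are bounded. For them the
  Poisson integral over a lower line is controlled by the norm of \<open>u\<close>, by Tonelli and translation
  invariance, uniformly in \<open>a\<close>; then \<open>a\<close> tends to \<open>0\<close>. The lower line is taken at half the height of \<open>w\<close>.
\<close>

theorem hardy_pointwise:
  assumes u: "u \<in> vecs hardy_space" and w: "0 < Im w"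
  shows "ennreal ((cmod (u w))\<^sup>2) \<le> ennreal (2 / (pi * Im w)) * hardy_norm_sq u"
proof -
  have hol: "u holomorphic_on upper_half_plane" using u by (simp add: hardy_iff)
  note cont = holomorphic_on_imp_continuous_on[OF hol]
  note [measurable] = hardy_measurable[OF u]
  obtain F where F_within: "\<And>z. z \<in> upper_half_plane \<Longrightarrow> (F has_field_derivative u z) (at z within upper_half_plane)"
    by (rule holomorphic_convex_primitive'[OF convex_upper_half_plane open_upper_half_plane hol]) (rule that)
  have F: "(F has_field_derivative u z) (at z)" if "z \<in> upper_half_plane" for z
    using F_within[OF that] unfolding at_within_open[OF that open_upper_half_plane] .
  have F_hol: "F holomorphic_on upper_half_plane"
    using F by (meson field_differentiable_at_within field_differentiable_def holomorphic_on_def)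
  define A where "A a z = (F (z + of_real a) - F z) / of_real a" for a z
  define y1 where "y1 = Im w / 2"
  have y1: "0 < y1" using w by (simp add: y1_def)
  let ?\<sigma> = "\<lambda>s z. ennreal ((cmod (u (z + of_real s)))\<^sup>2)"
  have A_le: "ennreal ((cmod (A a z))\<^sup>2) \<le> ennreal (1 / a) * (\<integral>\<^sup>+ s. indicator {0..a} s * ?\<sigma> s z \<partial>lborel)"
    if a: "0 < a" and z: "0 < Im z" for a z
  proof -
    have "ennreal ((cmod (A a z))\<^sup>2) = ennreal (1 / a\<^sup>2) * ennreal ((cmod (F (z + of_real a) - F z))\<^sup>2)"
      using a by (simp add: A_def norm_divide power_divide ennreal_mult'[symmetric])
    also have "\<dots> \<le> ennreal (1 / a\<^sup>2) * (ennreal a * (\<integral>\<^sup>+ s. indicator {0..a} s * ?\<sigma> s z \<partial>lborel))"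
      by (intro mult_left_mono primitive_increment_bound[OF F cont z a]) auto
    also have "\<dots> = ennreal (1 / a) * (\<integral>\<^sup>+ s. indicator {0..a} s * ?\<sigma> s z \<partial>lborel)"
      using a by (simp add: mult.assoc[symmetric] ennreal_mult'[symmetric] power2_eq_square)
    finally show ?thesis .
  qed
  have A_bdd: "\<exists>M. \<forall>z. 0 < Im z \<longrightarrow> cmod (A a z) \<le> M" if a: "0 < a" for a
  proof -
    let ?B = "ennreal (1 / a) * hardy_norm_sq u"
    have fin: "?B < top" using u by (simp add: hardy_iff ennreal_mult_less_top)
    have "cmod (A a z) \<le> sqrt (enn2real ?B)" if z: "0 < Im z" for z
    proof -
      have "(\<integral>\<^sup>+ s. indicator {0..a} s * ?\<sigma> s z \<partial>lborel) \<le> (\<integral>\<^sup>+ s. ?\<sigma> s z \<partial>lborel)"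
        by (intro nn_integral_mono) (auto split: split_indicator)
      also have "\<dots> = (\<integral>\<^sup>+ s. ennreal ((cmod (u (Complex (s + Re z) (Im z))))\<^sup>2) \<partial>lborel)"
      proof (rule nn_integral_cong)
        fix s :: real
        have "z + of_real s = Complex (s + Re z) (Im z)" by (simp add: complex_eq_iff)
        then show "?\<sigma> s z = ennreal ((cmod (u (Complex (s + Re z) (Im z))))\<^sup>2)" by simp
      qed
      also have "\<dots> = line_norm_sq u (Im z)"
        unfolding line_norm_sq_def by (rule nn_integral_shift) measurable
      also have "\<dots> \<le> hardy_norm_sq u" using z by (rule line_norm_sq_le)
      finally have "ennreal ((cmod (A a z))\<^sup>2) \<le> ?B"
        using order_trans[OF A_le[OF a z] mult_left_mono] by simp
      then have "(cmod (A a z))\<^sup>2 \<le> enn2real ?B"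
        using fin enn2real_mono by fastforce
      then show ?thesis by (rule real_le_rsqrt)
    qed
    then show ?thesis by blast
  qed
  have key: "ennreal ((cmod (A a w))\<^sup>2) \<le> ennreal (2 / (pi * Im w)) * hardy_norm_sq u" if a: "0 < a" for a
  proof -
    obtain M where M: "\<And>z. 0 < Im z \<Longrightarrow> cmod (A a z) \<le> M" using A_bdd[OF a] by blast
    define f where "f z = A a (z + of_real y1 * \<i>)" for z
    have shift: "z + of_real y1 * \<i> \<in> upper_half_plane" "z + of_real y1 * \<i> + of_real a \<in> upper_half_plane"
      if "- y1 < Im z" for z
      using that by (simp_all add: upper_half_plane_def)
    have f_hol: "f holomorphic_on {z. - y1 < Im z}"
      unfolding f_def A_def using a shift
      by (intro holomorphic_intros holomorphic_on_compose_gen[OF _ F_hol, unfolded o_def]) auto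
    have f_bdd: "cmod (f z) \<le> M" if "0 \<le> Im z" for z
      unfolding f_def using y1 that by (intro M) simp
    let ?w = "w - of_real y1 * \<i>"
    have Im_w: "Im ?w = y1" by (simp add: y1_def)
    have "ennreal ((cmod (A a w))\<^sup>2) = ennreal ((cmod (f ?w))\<^sup>2)" by (simp add: f_def)
    also have "\<dots> \<le> (\<integral>\<^sup>+ t. ennreal (poisson_kernel ?w t) * ennreal ((cmod (f (of_real t)))\<^sup>2) \<partial>lborel)"
      by (rule poisson_submean[OF y1 f_hol f_bdd]) (use Im_w y1 in auto)
    also have "\<dots> \<le> (\<integral>\<^sup>+ t. ennreal (1 / (pi * y1)) * (ennreal (1 / a) *
        (\<integral>\<^sup>+ s. indicator {0..a} s * ennreal ((cmod (u (Complex (t + s) y1)))\<^sup>2) \<partial>lborel)) \<partial>lborel)"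
    proof (intro nn_integral_mono mult_mono)
      fix t :: real
      show "ennreal (poisson_kernel ?w t) \<le> ennreal (1 / (pi * y1))"
        using poisson_kernel_le[of ?w t] Im_w y1 by (simp add: ennreal_leI)
      have "of_real t + of_real y1 * \<i> + of_real s = Complex (t + s) y1" for s
        by (simp add: complex_eq_iff)
      then show "ennreal ((cmod (f (of_real t)))\<^sup>2) \<le> ennreal (1 / a) *
        (\<integral>\<^sup>+ s. indicator {0..a} s * ennreal ((cmod (u (Complex (t + s) y1)))\<^sup>2) \<partial>lborel)"
        using A_le[OF a, of "of_real t + of_real y1 * \<i>"] y1 by (simp add: f_def)
    qed auto
    also have "\<dots> = ennreal (1 / (pi * y1)) * (ennreal (1 / a) * (\<integral>\<^sup>+ t. \<integral>\<^sup>+ s.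
        indicator {0..a} s * ennreal ((cmod (u (Complex (t + s) y1)))\<^sup>2) \<partial>lborel \<partial>lborel))"
      by (simp add: nn_integral_cmult)
    also have "(\<integral>\<^sup>+ t. \<integral>\<^sup>+ s. indicator {0..a} s * ennreal ((cmod (u (Complex (t + s) y1)))\<^sup>2) \<partial>lborel \<partial>lborel)
       = (\<integral>\<^sup>+ s. \<integral>\<^sup>+ t. indicator {0..a} s * ennreal ((cmod (u (Complex (t + s) y1)))\<^sup>2) \<partial>lborel \<partial>lborel)"
      by (rule lborel_pair.Fubini') measurable
    also have "\<dots> = (\<integral>\<^sup>+ s. indicator {0..a} s * line_norm_sq u y1 \<partial>lborel)"
      unfolding line_norm_sq_def
      by (intro nn_integral_cong) (subst nn_integral_cmult, measurable, subst nn_integral_shift, measurable)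
    also have "\<dots> = ennreal a * line_norm_sq u y1"
      using a by (simp add: nn_integral_multc)
    also have "ennreal (1 / (pi * y1)) * (ennreal (1 / a) * (ennreal a * line_norm_sq u y1)) =
        ennreal (1 / (pi * y1)) * line_norm_sq u y1"
      using a by (simp add: mult.assoc[symmetric] ennreal_mult'[symmetric])
    also have "\<dots> \<le> ennreal (1 / (pi * y1)) * hardy_norm_sq u"
      by (intro mult_left_mono line_norm_sq_le y1) simp
    finally show ?thesis by (simp add: y1_def)
  qed
  have "((\<lambda>a. A a w) \<longlongrightarrow> u w) (at 0)"
  proof -
    have "((\<lambda>h. (F (w + h) - F w) / h) \<longlongrightarrow> u w) (at 0)"
      using F[of w] w by (simp add: upper_half_plane_def DERIV_def)
    moreover have "filterlim complex_of_real (at 0) (at 0)"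
      unfolding filterlim_at by (auto intro!: tendsto_eq_intros simp: eventually_at_filter)
    ultimately show ?thesis
      unfolding A_def by (rule filterlim_compose)
  qed
  then have "((\<lambda>a. A a w) \<longlongrightarrow> u w) (at_right 0)"
    by (rule filterlim_mono) (simp_all add: at_le)
  then have "((\<lambda>a. ennreal ((cmod (A a w))\<^sup>2)) \<longlongrightarrow> ennreal ((cmod (u w))\<^sup>2)) (at_right 0)"
    by (intro tendsto_intros tendsto_ennrealI)
  moreover have "\<forall>\<^sub>F a in at_right 0. ennreal ((cmod (A a w))\<^sup>2) \<le> ennreal (2 / (pi * Im w)) * hardy_norm_sq u"
    using eventually_at_right_less[of 0] by eventually_elim (rule key)
  ultimately show ?thesis
    by (rule tendsto_upperbound) simp
qed

section \<open>Contractivity of composition operators\<close>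

lemma measurable_poisson_kernel [measurable (raw)]:
  "f \<in> borel_measurable M \<Longrightarrow> g \<in> borel_measurable M \<Longrightarrow> (\<lambda>x. poisson_kernel (f x) (g x)) \<in> borel_measurable M"
proof -
  assume [measurable]: "f \<in> borel_measurable M" "g \<in> borel_measurable M"
  have [measurable]: "(\<lambda>x. Im (f x)) \<in> borel_measurable M"
    by (rule borel_measurable_continuous_on[where f = Im]) (auto intro: continuous_intros)
  show ?thesis unfolding poisson_kernel_def by measurable
qed

text \<open>
  The limit says that \<open>\<phi>\<close> has angular derivative \<open>1\<close> at infinity; sampling it along the imaginary axis is
  enough for the Poisson formula.
\<close>

definition parabolic_self_map :: "(complex \<Rightarrow> complex) \<Rightarrow> bool" where
  "parabolic_self_map \<phi> \<longleftrightarrow> \<phi> holomorphic_on upper_half_plane \<and>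
     (\<forall>z\<in>upper_half_plane. Im z \<le> Im (\<phi> z)) \<and> ((\<lambda>s. \<phi> (\<i> * of_real s) / of_real s) \<longlongrightarrow> \<i>) at_top"

lemma line_measurable:
  assumes "\<phi> holomorphic_on upper_half_plane" and "0 < y"
  shows "(\<lambda>x. \<phi> (Complex x y)) \<in> borel_measurable borel"
proof -
  have "continuous_on UNIV (\<lambda>x. \<phi> (Complex x y))"
    by (intro continuous_on_compose2[OF holomorphic_on_imp_continuous_on[OF assms(1)]] continuous_intros)
      (use assms(2) in \<open>auto simp: upper_half_plane_def\<close>)
  then show ?thesis by (rule borel_measurable_continuous_onI)
qed

lemma Im_minus_inverse: "Im (- (1 / \<zeta>)) = Im \<zeta> / (cmod \<zeta>)\<^sup>2"
  by (simp add: Im_divide cmod_power2)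

text \<open>
  The function \<open>f = - 1 / (\<phi> - c)\<close> is bounded with positive imaginary part above the line of height \<open>y\<close>.
  Poisson's formula at height \<open>s\<close> above that line, multiplied by \<open>s\<close>, integrates \<open>Im f\<close> against
  \<open>s\<^sup>2 / (x\<^sup>2 + s\<^sup>2)\<close> up to a factor \<open>\<pi>\<close>. As \<open>s\<close> tends to infinity, the weight tends to \<open>1\<close> and \<open>s f (\<i> s)\<close> to
  \<open>\<i>\<close>, and Fatou's lemma gives the bound.
\<close>

lemma poisson_mass_le_one:
  assumes \<phi>: "parabolic_self_map \<phi>" and y: "0 < y" "Im c < y"
  shows "(\<integral>\<^sup>+ x. ennreal (poisson_kernel (\<phi> (Complex x y) - c) 0) \<partial>lborel) \<le> 1"
proof -
  have hol: "\<phi> holomorphic_on upper_half_plane"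
    and Im_ge: "\<And>z. z \<in> upper_half_plane \<Longrightarrow> Im z \<le> Im (\<phi> z)"
    and lim: "((\<lambda>s. \<phi> (\<i> * of_real s) / of_real s) \<longlongrightarrow> \<i>) at_top"
    using \<phi> by (auto simp: parabolic_self_map_def)
  have [measurable]: "(\<lambda>x. \<phi> (Complex x y)) \<in> borel_measurable borel"
    using hol y(1) by (rule line_measurable)
  define \<zeta> where "\<zeta> z = \<phi> (z + of_real y * \<i>) - c" for z
  define f where "f z = - (1 / \<zeta> z)" for z
  define \<eta> where "\<eta> = min y (y - Im c)"
  have \<eta>: "0 < \<eta>" using y by (simp add: \<eta>_def)
  have shift: "z + of_real y * \<i> \<in> upper_half_plane" if "- \<eta> < Im z" for z
    using that by (simp add: upper_half_plane_def \<eta>_def)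
  have Im_\<zeta>: "Im z + y - Im c \<le> Im (\<zeta> z)" if "- \<eta> < Im z" for z
    using Im_ge[OF shift[OF that]] by (simp add: \<zeta>_def)
  have Im_pos: "0 < Im (\<zeta> z)" if "- \<eta> < Im z" for z
    using Im_\<zeta>[OF that] that by (simp add: \<eta>_def)
  have \<zeta>0: "\<zeta> z \<noteq> 0" if "- \<eta> < Im z" for z
    using Im_pos[OF that] by auto
  have f_hol: "f holomorphic_on {z. - \<eta> < Im z}"
    unfolding f_def
  proof (intro holomorphic_intros)
    show "\<zeta> holomorphic_on {z. - \<eta> < Im z}"
      unfolding \<zeta>_def using shift
      by (intro holomorphic_intros holomorphic_on_compose_gen[OF _ hol, unfolded o_def]) auto
  qed (use \<zeta>0 in auto)
  have f_bdd: "cmod (f z) \<le> 1 / (y - Im c)" if z: "0 \<le> Im z" for z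
  proof -
    have "y - Im c \<le> cmod (\<zeta> z)"
      using Im_\<zeta>[of z] z \<eta> abs_Im_le_cmod[of "\<zeta> z"] by simp
    then show ?thesis using y(2) by (simp add: f_def norm_divide frac_le)
  qed
  let ?K = "\<lambda>x. poisson_kernel (\<phi> (Complex x y) - c) 0"
  have real_line: "\<zeta> (of_real x) = \<phi> (Complex x y) - c" for x
  proof -
    have "of_real x + of_real y * \<i> = Complex x y" by (simp add: complex_eq_iff)
    then show ?thesis by (simp add: \<zeta>_def)
  qed
  have K: "?K x = Im (f (of_real x)) / pi" for x
    unfolding f_def Im_minus_inverse real_line[symmetric] poisson_kernel_def
    by (simp add: mult.commute)
  have K_nonneg: "0 \<le> ?K x" for x
    using Im_pos[of "of_real x"] \<eta> by (simp add: poisson_kernel_nonneg real_line)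
  have weighted: "(\<integral>\<^sup>+ x. ennreal (s\<^sup>2 / (x\<^sup>2 + s\<^sup>2) * ?K x) \<partial>lborel) \<le> ennreal (cmod (of_real s * f (\<i> * of_real s)))"
    if s: "0 < s" for s
  proof -
    have "has_bochner_integral lborel (\<lambda>x. of_real (poisson_kernel (\<i> * of_real s) x) * f (of_real x)) (f (\<i> * of_real s))"
      by (rule poisson_formula[OF \<eta> f_hol f_bdd]) (use s in auto)
    then have "has_bochner_integral lborel (\<lambda>x. s * Im (of_real (poisson_kernel (\<i> * of_real s) x) * f (of_real x)))
        (s * Im (f (\<i> * of_real s)))"
      by (intro has_bochner_integral_mult_right has_bochner_integral_Im)
    moreover have "s * Im (of_real (poisson_kernel (\<i> * of_real s) x) * f (of_real x)) = s\<^sup>2 / (x\<^sup>2 + s\<^sup>2) * ?K x" for x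
      unfolding poisson_kernel_def[of "\<i> * of_real s"] cmod_real_minus_sq K
      by (simp add: power2_eq_square mult_ac)
    ultimately have B: "has_bochner_integral lborel (\<lambda>x. s\<^sup>2 / (x\<^sup>2 + s\<^sup>2) * ?K x) (s * Im (f (\<i> * of_real s)))"
      by simp
    have "(\<integral>\<^sup>+ x. ennreal (s\<^sup>2 / (x\<^sup>2 + s\<^sup>2) * ?K x) \<partial>lborel) = ennreal (s * Im (f (\<i> * of_real s)))"
      using B K_nonneg by (subst nn_integral_eq_integral) (auto simp: has_bochner_integral_iff)
    also have "\<dots> \<le> ennreal (cmod (of_real s * f (\<i> * of_real s)))"
      using s abs_Im_le_cmod[of "f (\<i> * of_real s)"] by (intro ennreal_leI) (simp add: norm_mult)
    finally show ?thesis .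
  qed
  have "((\<lambda>s. of_real s * f (\<i> * of_real s)) \<longlongrightarrow> - (1 / (\<i> * 1 - 0))) at_top"
  proof (rule Lim_transform_eventually)
    have shifted: "((\<lambda>s. \<phi> (\<i> * of_real (s + y)) / of_real (s + y)) \<longlongrightarrow> \<i>) at_top"
      by (rule filterlim_compose[OF lim]) real_asymp
    have ratio: "((\<lambda>s. complex_of_real ((s + y) / s)) \<longlongrightarrow> of_real 1) at_top"
      by (intro tendsto_of_real) real_asymp
    have "((\<lambda>s. c * complex_of_real (1 / s)) \<longlongrightarrow> c * of_real 0) at_top"
      by (intro tendsto_mult tendsto_const tendsto_of_real) real_asymp
    then have small: "((\<lambda>s. c / complex_of_real s) \<longlongrightarrow> 0) at_top" by simp
    show "((\<lambda>s. - (1 / (\<phi> (\<i> * of_real (s + y)) / of_real (s + y) * complex_of_real ((s + y) / s) - c / of_real s)))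
        \<longlongrightarrow> - (1 / (\<i> * 1 - 0))) at_top"
      using ratio by (intro tendsto_intros shifted small) simp_all
    show "\<forall>\<^sub>F s in at_top. - (1 / (\<phi> (\<i> * of_real (s + y)) / of_real (s + y) * complex_of_real ((s + y) / s) - c / of_real s))
        = of_real s * f (\<i> * of_real s)"
      using eventually_gt_at_top[of 0]
    proof eventually_elim
      case (elim s)
      have e: "\<i> * of_real s + of_real y * \<i> = \<i> * of_real (s + y)" by (simp add: algebra_simps)
      have "complex_of_real (s + y) \<noteq> 0" "complex_of_real s \<noteq> 0"
        using elim y(1) by (simp_all only: of_real_eq_0_iff)
      then have "\<phi> (\<i> * of_real (s + y)) / of_real (s + y) * complex_of_real ((s + y) / s) - c / of_real s
          = \<zeta> (\<i> * of_real s) / of_real s"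
        unfolding \<zeta>_def e of_real_divide by (simp add: diff_divide_distrib)
      then show ?case by (simp add: f_def)
    qed
  qed
  then have "((\<lambda>s. ennreal (cmod (of_real s * f (\<i> * of_real s)))) \<longlongrightarrow> ennreal (cmod (- (1 / (\<i> * 1 - 0))))) at_top"
    by (intro tendsto_ennrealI tendsto_norm)
  then have "((\<lambda>s. ennreal (cmod (of_real s * f (\<i> * of_real s)))) \<longlongrightarrow> 1) at_top"
    by (simp add: norm_divide)
  then have L: "(\<lambda>n. ennreal (cmod (of_real (real n) * f (\<i> * of_real (real n))))) \<longlonglongrightarrow> 1"
    by (rule filterlim_compose) (rule filterlim_real_sequentially)
  have "(\<integral>\<^sup>+ x. ennreal (?K x) \<partial>lborel) =
      (\<integral>\<^sup>+ x. liminf (\<lambda>n. ennreal ((real n)\<^sup>2 / (x\<^sup>2 + (real n)\<^sup>2) * ?K x)) \<partial>lborel)"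
  proof (rule nn_integral_cong)
    fix x
    have "(\<lambda>n. (real n)\<^sup>2 / (x\<^sup>2 + (real n)\<^sup>2)) \<longlonglongrightarrow> 1" by real_asymp
    then have "(\<lambda>n. ennreal ((real n)\<^sup>2 / (x\<^sup>2 + (real n)\<^sup>2) * ?K x)) \<longlonglongrightarrow> ennreal (1 * ?K x)"
      by (intro tendsto_ennrealI tendsto_mult tendsto_const)
    then show "ennreal (?K x) = liminf (\<lambda>n. ennreal ((real n)\<^sup>2 / (x\<^sup>2 + (real n)\<^sup>2) * ?K x))"
      by (simp add: lim_imp_Liminf)
  qed
  also have "\<dots> \<le> liminf (\<lambda>n. \<integral>\<^sup>+ x. ennreal ((real n)\<^sup>2 / (x\<^sup>2 + (real n)\<^sup>2) * ?K x) \<partial>lborel)"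
    by (rule nn_integral_liminf) measurable
  also have "\<dots> \<le> liminf (\<lambda>n. ennreal (cmod (of_real (real n) * f (\<i> * of_real (real n)))))"
    by (rule Liminf_mono) (use eventually_gt_at_top[of 0] in eventually_elim, simp only: weighted of_nat_0_less_iff)
  also have "\<dots> = 1" using L by (simp add: lim_imp_Liminf)
  finally show ?thesis .
qed

text \<open>
  Each value of \<open>|u|\<^sup>2\<close> on the image curve is at most the Poisson integral of \<open>|u|\<^sup>2\<close> over the line of height
  \<open>y0\<close>. After exchanging the integrals, \<open>poisson_mass_le_one\<close> bounds the mass received by each point of
  that line.
\<close>

theorem subordination:
  assumes \<phi>: "parabolic_self_map \<phi>" and u: "u \<in> vecs hardy_space" and y: "0 < y0" "y0 < y"
  shows "(\<integral>\<^sup>+ x. ennreal ((cmod (u (\<phi> (Complex x y))))\<^sup>2) \<partial>lborel) \<le> line_norm_sq u y0"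
proof -
  have hol: "\<phi> holomorphic_on upper_half_plane"
    and Im_ge: "\<And>z. z \<in> upper_half_plane \<Longrightarrow> Im z \<le> Im (\<phi> z)"
    using \<phi> by (auto simp: parabolic_self_map_def)
  have u_hol: "u holomorphic_on upper_half_plane" using u by (simp add: hardy_iff)
  note [measurable] = hardy_measurable[OF u]
  have [measurable]: "(\<lambda>x. \<phi> (Complex x y)) \<in> borel_measurable borel"
    using hol y by (intro line_measurable) auto
  define f where "f z = u (z + of_real y0 * \<i>)" for z
  define w where "w x = \<phi> (Complex x y) - of_real y0 * \<i>" for x
  have w: "0 < Im (w x)" for x
    using Im_ge[of "Complex x y"] y by (simp add: upper_half_plane_def w_def)
  have f_hol: "f holomorphic_on {z. - y0 < Im z}"
    unfolding f_def
    by (intro holomorphic_intros holomorphic_on_compose_gen[OF _ u_hol, unfolded o_def])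
      (auto simp: upper_half_plane_def)
  define M where "M = sqrt (enn2real (ennreal (2 / (pi * y0)) * hardy_norm_sq u))"
  have f_bdd: "cmod (f z) \<le> M" if z: "0 \<le> Im z" for z
  proof -
    have fin: "ennreal (2 / (pi * y0)) * hardy_norm_sq u < top"
      using u by (simp add: hardy_iff ennreal_mult_less_top)
    have "ennreal ((cmod (f z))\<^sup>2) \<le> ennreal (2 / (pi * (Im z + y0))) * hardy_norm_sq u"
      using hardy_pointwise[OF u, of "z + of_real y0 * \<i>"] z y by (simp add: f_def)
    also have "\<dots> \<le> ennreal (2 / (pi * y0)) * hardy_norm_sq u"
      using z y by (intro mult_right_mono ennreal_leI frac_le) auto
    finally have "(cmod (f z))\<^sup>2 \<le> enn2real (ennreal (2 / (pi * y0)) * hardy_norm_sq u)"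
      using fin enn2real_mono by fastforce
    then show ?thesis unfolding M_def by (rule real_le_rsqrt)
  qed
  have line: "of_real t + of_real y0 * \<i> = Complex t y0" for t by (simp add: complex_eq_iff)
  have "(\<integral>\<^sup>+ x. ennreal ((cmod (u (\<phi> (Complex x y))))\<^sup>2) \<partial>lborel) \<le>
     (\<integral>\<^sup>+ x. \<integral>\<^sup>+ t. ennreal (poisson_kernel (w x) t) * ennreal ((cmod (u (Complex t y0)))\<^sup>2) \<partial>lborel \<partial>lborel)"
  proof (rule nn_integral_mono)
    fix x
    show "ennreal ((cmod (u (\<phi> (Complex x y))))\<^sup>2) \<le>
      (\<integral>\<^sup>+ t. ennreal (poisson_kernel (w x) t) * ennreal ((cmod (u (Complex t y0)))\<^sup>2) \<partial>lborel)"
      using poisson_submean[OF y(1) f_hol f_bdd w[of x]] by (simp add: f_def w_def line)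
  qed
  also have "\<dots> = (\<integral>\<^sup>+ t. \<integral>\<^sup>+ x. ennreal (poisson_kernel (w x) t) * ennreal ((cmod (u (Complex t y0)))\<^sup>2) \<partial>lborel \<partial>lborel)"
    unfolding w_def by (rule lborel_pair.Fubini') measurable
  also have "\<dots> \<le> (\<integral>\<^sup>+ t. 1 * ennreal ((cmod (u (Complex t y0)))\<^sup>2) \<partial>lborel)"
  proof (rule nn_integral_mono)
    fix t
    have "poisson_kernel (w x) t = poisson_kernel (\<phi> (Complex x y) - Complex t y0) 0" for x
    proof -
      have "(cmod (of_real t - w x))\<^sup>2 = (cmod (of_real 0 - (\<phi> (Complex x y) - Complex t y0)))\<^sup>2"
        unfolding cmod_real_minus_sq by (simp add: w_def power2_commute)
      then show ?thesis unfolding poisson_kernel_def by (simp add: w_def)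
    qed
    then have "(\<integral>\<^sup>+ x. ennreal (poisson_kernel (w x) t) \<partial>lborel) \<le> 1"
      using poisson_mass_le_one[OF \<phi>, of y "Complex t y0"] y by simp
    moreover have "(\<integral>\<^sup>+ x. ennreal (poisson_kernel (w x) t) * ennreal ((cmod (u (Complex t y0)))\<^sup>2) \<partial>lborel)
      = (\<integral>\<^sup>+ x. ennreal (poisson_kernel (w x) t) \<partial>lborel) * ennreal ((cmod (u (Complex t y0)))\<^sup>2)"
      unfolding w_def by (rule nn_integral_multc) measurable
    ultimately show "(\<integral>\<^sup>+ x. ennreal (poisson_kernel (w x) t) * ennreal ((cmod (u (Complex t y0)))\<^sup>2) \<partial>lborel)
      \<le> 1 * ennreal ((cmod (u (Complex t y0)))\<^sup>2)"
      by (simp add: mult_right_mono del: mult_1)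
  qed
  also have "\<dots> = line_norm_sq u y0" by (simp add: line_norm_sq_def)
  finally show ?thesis .
qed

text \<open>
  Subordination for the identity map.
\<close>

lemma line_norm_sq_antimono:
  assumes u: "u \<in> vecs hardy_space" and y: "0 < y0" "y0 \<le> y"
  shows "line_norm_sq u y \<le> line_norm_sq u y0"
proof (cases "y0 = y")
  case False
  have "parabolic_self_map (\<lambda>z. z)"
    unfolding parabolic_self_map_def
  proof (intro conjI)
    show "((\<lambda>s. \<i> * of_real s / of_real s) \<longlongrightarrow> \<i>) at_top"
      by (rule tendsto_eventually) (use eventually_gt_at_top[of 0] in eventually_elim, simp)
  qed auto
  from subordination[OF this u, of y0 y] y False show ?thesis by (simp add: line_norm_sq_def)
qed simp

lemma composition_op_line_norm_sq:
  "0 < y \<Longrightarrow> line_norm_sq (composition_op \<phi> u) y = (\<integral>\<^sup>+ x. ennreal ((cmod (u (\<phi> (Complex x y))))\<^sup>2) \<partial>lborel)"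
  by (simp add: line_norm_sq_def composition_op_def upper_half_plane_def)

theorem composition_op_contraction:
  assumes \<phi>: "parabolic_self_map \<phi>" and u: "u \<in> vecs hardy_space"
  shows "composition_op \<phi> u \<in> vecs hardy_space"
    and "hardy_norm_sq (composition_op \<phi> u) \<le> hardy_norm_sq u"
proof -
  have hol: "\<phi> holomorphic_on upper_half_plane"
    and Im_ge: "\<And>z. z \<in> upper_half_plane \<Longrightarrow> Im z \<le> Im (\<phi> z)"
    using \<phi> by (auto simp: parabolic_self_map_def)
  have u_hol: "u holomorphic_on upper_half_plane" using u by (simp add: hardy_iff)
  show le: "hardy_norm_sq (composition_op \<phi> u) \<le> hardy_norm_sq u"
    unfolding hardy_norm_sq_eq[of "composition_op \<phi> u"]
  proof (rule SUP_least)
    fix y :: real assume "y \<in> {0<..}"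
    then have y: "0 < y" by simp
    have "line_norm_sq (composition_op \<phi> u) y \<le> line_norm_sq u (y / 2)"
      unfolding composition_op_line_norm_sq[OF y] by (rule subordination[OF \<phi> u]) (use y in auto)
    also have "\<dots> \<le> hardy_norm_sq u" using y by (intro line_norm_sq_le) simp
    finally show "line_norm_sq (composition_op \<phi> u) y \<le> hardy_norm_sq u" .
  qed
  have "(\<lambda>z. u (\<phi> z)) holomorphic_on upper_half_plane"
    by (rule holomorphic_on_compose_gen[OF hol u_hol, unfolded o_def])
      (use Im_ge in \<open>fastforce simp: upper_half_plane_def\<close>)
  then have "composition_op \<phi> u holomorphic_on upper_half_plane"
    by (rule holomorphic_transform) (simp add: composition_op_def)
  moreover have "hardy_norm_sq (composition_op \<phi> u) < \<infinity>"
    using le_less_trans[OF le] u by (simp add: hardy_iff)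
  ultimately show "composition_op \<phi> u \<in> vecs hardy_space"
    by (simp add: hardy_iff composition_op_def)
qed

section \<open>Completeness and convergence in the Hardy space\<close>

lemma line_norm_sq_add_le:
  assumes u: "u holomorphic_on upper_half_plane" and v: "v holomorphic_on upper_half_plane" and y: "0 < y"
  shows "line_norm_sq (\<lambda>z. u z + v z) y \<le> 2 * line_norm_sq u y + 2 * line_norm_sq v y"
proof -
  note [measurable] = line_measurable[OF u y] line_measurable[OF v y]
  have "line_norm_sq (\<lambda>z. u z + v z) y \<le>
    (\<integral>\<^sup>+ x. 2 * ennreal ((cmod (u (Complex x y)))\<^sup>2) + 2 * ennreal ((cmod (v (Complex x y)))\<^sup>2) \<partial>lborel)"
    unfolding line_norm_sq_def
  proof (rule nn_integral_mono)
    fix x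
    let ?a = "cmod (u (Complex x y))" and ?b = "cmod (v (Complex x y))"
    have "(cmod (u (Complex x y) + v (Complex x y)))\<^sup>2 \<le> (?a + ?b)\<^sup>2"
      by (intro power_mono norm_triangle_ineq) simp
    also have "\<dots> \<le> 2 * ?a\<^sup>2 + 2 * ?b\<^sup>2"
      using sum_squares_bound[of ?a ?b] by (simp add: power2_sum)
    finally have "ennreal ((cmod (u (Complex x y) + v (Complex x y)))\<^sup>2) \<le> ennreal (2 * ?a\<^sup>2 + 2 * ?b\<^sup>2)"
      by (rule ennreal_leI)
    also have "\<dots> = 2 * ennreal (?a\<^sup>2) + 2 * ennreal (?b\<^sup>2)"
      by (simp add: ennreal_plus ennreal_mult')
    finally show "ennreal ((cmod (u (Complex x y) + v (Complex x y)))\<^sup>2) \<le> 2 * ennreal (?a\<^sup>2) + 2 * ennreal (?b\<^sup>2)" .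
  qed
  also have "\<dots> = 2 * line_norm_sq u y + 2 * line_norm_sq v y"
    unfolding line_norm_sq_def by (simp add: nn_integral_add nn_integral_cmult)
  finally show ?thesis .
qed

lemma hardy_norm_sq_add_le:
  assumes u: "u holomorphic_on upper_half_plane" and v: "v holomorphic_on upper_half_plane"
  shows "hardy_norm_sq (\<lambda>z. u z + v z) \<le> 2 * hardy_norm_sq u + 2 * hardy_norm_sq v"
  unfolding hardy_norm_sq_eq[of "\<lambda>z. u z + v z"]
proof (rule SUP_least)
  fix y :: real assume "y \<in> {0<..}"
  then have y: "0 < y" by simp
  have "line_norm_sq (\<lambda>z. u z + v z) y \<le> 2 * line_norm_sq u y + 2 * line_norm_sq v y"
    by (rule line_norm_sq_add_le[OF u v y])
  also have "\<dots> \<le> 2 * hardy_norm_sq u + 2 * hardy_norm_sq v"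
    by (intro add_mono mult_left_mono line_norm_sq_le y) auto
  finally show "line_norm_sq (\<lambda>z. u z + v z) y \<le> 2 * hardy_norm_sq u + 2 * hardy_norm_sq v" .
qed

lemma hardy_add:
  assumes "u \<in> vecs hardy_space" "v \<in> vecs hardy_space"
  shows "(\<lambda>z. u z + v z) \<in> vecs hardy_space"
  using assms le_less_trans[OF hardy_norm_sq_add_le[of u v]]
  by (auto simp: hardy_iff ennreal_mult_less_top intro!: holomorphic_intros)

lemma hardy_scale:
  assumes u: "u \<in> vecs hardy_space"
  shows "(\<lambda>z. c * u z) \<in> vecs hardy_space"
proof -
  note [measurable] = hardy_measurable[OF u]
  have "line_norm_sq (\<lambda>z. c * u z) y = ennreal ((cmod c)\<^sup>2) * line_norm_sq u y" for y
    unfolding line_norm_sq_def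
    by (subst nn_integral_cmult[symmetric]) (auto simp: norm_mult power_mult_distrib ennreal_mult)
  then have "hardy_norm_sq (\<lambda>z. c * u z) \<le> ennreal ((cmod c)\<^sup>2) * hardy_norm_sq u"
    unfolding hardy_norm_sq_eq[of "\<lambda>z. c * u z"]
    by (intro SUP_least) (auto intro: mult_left_mono line_norm_sq_le)
  also have "\<dots> < \<infinity>" using u by (simp add: hardy_iff ennreal_mult_less_top)
  finally show ?thesis using u by (auto simp: hardy_iff intro!: holomorphic_intros)
qed

lemma hardy_diff:
  assumes "u \<in> vecs hardy_space" "v \<in> vecs hardy_space"
  shows "(\<lambda>z. u z - v z) \<in> vecs hardy_space"
  using hardy_add[OF assms(1) hardy_scale[OF assms(2), of "-1"]] by simp

lemma hardy_space_simps:
  "vzero hardy_space = (\<lambda>z. 0)" "vadd hardy_space u v = (\<lambda>z. u z + v z)"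
  "vscale hardy_space c u = (\<lambda>z. c * u z)" "vdiff hardy_space u v = (\<lambda>z. u z - v z)"
  "vnorm hardy_space u = sqrt (enn2real (hardy_norm_sq u))"
  by (simp_all add: hardy_space_def vdiff_def)

lemma hardy_norm_sq_zero: "hardy_norm_sq (\<lambda>z. 0) = 0"
  by (simp add: hardy_norm_sq_def)

lemma hardy_vector_space: "complex_vector_space hardy_space"
proof
  show "\<exists>y\<in>vecs hardy_space. vadd hardy_space x y = vzero hardy_space" if "x \<in> vecs hardy_space" for x
    using hardy_scale[OF that, of "-1"] by (intro bexI[of _ "\<lambda>z. -1 * x z"]) (auto simp: hardy_space_simps)
  show "vzero hardy_space \<in> vecs hardy_space"
    by (simp add: hardy_space_simps hardy_iff hardy_norm_sq_zero)
qed (auto simp: hardy_space_simps hardy_add hardy_scale algebra_simps)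

lemma hardy_norm_sq_conv:
  assumes "u \<in> vecs hardy_space"
  shows "hardy_norm_sq u = ennreal ((vnorm hardy_space u)\<^sup>2)"
  using assms by (simp add: hardy_space_simps hardy_iff)

lemma line_norm_sq_tendsto:
  assumes u: "u \<in> vecs hardy_space"
  shows "(\<lambda>n. line_norm_sq u (1 / real (Suc n))) \<longlonglongrightarrow> hardy_norm_sq u"
proof -
  have "incseq (\<lambda>n. line_norm_sq u (1 / real (Suc n)))"
    by (intro incseq_SucI line_norm_sq_antimono[OF u]) (auto simp: field_simps)
  then have "(\<lambda>n. line_norm_sq u (1 / real (Suc n))) \<longlonglongrightarrow> (SUP n. line_norm_sq u (1 / real (Suc n)))"
    by (rule LIMSEQ_SUP)
  also have "(SUP n. line_norm_sq u (1 / real (Suc n))) = hardy_norm_sq u"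
    unfolding hardy_norm_sq_eq
  proof (rule antisym)
    show "(SUP n. line_norm_sq u (1 / real (Suc n))) \<le> (SUP y\<in>{0<..}. line_norm_sq u y)"
      by (intro SUP_least SUP_upper) simp
    show "(SUP y\<in>{0<..}. line_norm_sq u y) \<le> (SUP n. line_norm_sq u (1 / real (Suc n)))"
    proof (rule SUP_mono)
      fix y :: real assume "y \<in> {0<..}"
      then obtain n where n: "1 / real (Suc n) < y" using nat_approx_posE by auto
      then show "\<exists>n\<in>UNIV. line_norm_sq u y \<le> line_norm_sq u (1 / real (Suc n))"
        by (intro bexI[of _ n] line_norm_sq_antimono[OF u]) auto
    qed
  qed
  finally show ?thesis .
qed

lemma line_square_integrable:
  assumes u: "u \<in> vecs hardy_space" and y: "0 < y"
  shows "integrable lborel (\<lambda>x. (cmod (u (Complex x y)))\<^sup>2)"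
proof (rule integrableI_bounded)
  note [measurable] = hardy_measurable[OF u]
  show "(\<lambda>x. (cmod (u (Complex x y)))\<^sup>2) \<in> borel_measurable lborel" by measurable
  show "(\<integral>\<^sup>+ x. ennreal (norm ((cmod (u (Complex x y)))\<^sup>2)) \<partial>lborel) < \<infinity>"
    using line_norm_sq_le[OF y, of u] u by (auto simp: line_norm_sq_def hardy_iff intro: le_less_trans)
qed

lemma hardy_norm_inner: "\<exists>ip. norm_from_inner hardy_space ip"
proof (rule norm_from_inner_limit[OF hardy_vector_space])
  let ?p = "\<lambda>n u. sqrt (enn2real (line_norm_sq u (1 / real (Suc n))))"
  fix n
  define y where "y = 1 / real (Suc n)"
  have y: "0 < y" by (simp add: y_def)
  define ip where "ip u v = (\<integral>x. u (Complex x y) * cnj (v (Complex x y)) \<partial>lborel)" for u v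
  have int: "integrable lborel (\<lambda>x. u (Complex x y) * cnj (v (Complex x y)))"
    if u: "u \<in> vecs hardy_space" and v: "v \<in> vecs hardy_space" for u v
  proof (rule Bochner_Integration.integrable_bound)
    note [measurable] = hardy_measurable[OF u] hardy_measurable[OF v]
    show "integrable lborel (\<lambda>x. (cmod (u (Complex x y)))\<^sup>2 + (cmod (v (Complex x y)))\<^sup>2)"
      by (intro Bochner_Integration.integrable_add line_square_integrable u v y)
    show "(\<lambda>x. u (Complex x y) * cnj (v (Complex x y))) \<in> borel_measurable lborel"
      by (intro borel_measurable_times borel_measurable_continuous_on[where f = cnj] continuous_intros) measurable
    show "AE x in lborel. norm (u (Complex x y) * cnj (v (Complex x y))) \<le>
        norm ((cmod (u (Complex x y)))\<^sup>2 + (cmod (v (Complex x y)))\<^sup>2)"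
    proof (rule AE_I2)
      fix x
      let ?a = "cmod (u (Complex x y))" and ?b = "cmod (v (Complex x y))"
      have "2 * (?a * ?b) \<le> ?a\<^sup>2 + ?b\<^sup>2" using sum_squares_bound[of ?a ?b] by (simp add: mult.assoc)
      moreover have "0 \<le> ?a * ?b" by simp
      ultimately have "?a * ?b \<le> ?a\<^sup>2 + ?b\<^sup>2" by linarith
      then show "norm (u (Complex x y) * cnj (v (Complex x y))) \<le> norm (?a\<^sup>2 + ?b\<^sup>2)"
        by (simp add: norm_mult)
    qed
  qed
  have "norm_from_inner (hardy_space\<lparr>vnorm := ?p n\<rparr>) ip"
    unfolding norm_from_inner_def
  proof (intro conjI ballI allI)
    let ?K = "hardy_space\<lparr>vnorm := ?p n\<rparr>"
    have K: "vecs ?K = vecs hardy_space" "vadd ?K = vadd hardy_space" "vscale ?K = vscale hardy_space" "vnorm ?K = ?p n"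
      by simp_all
    fix u v w c assume "u \<in> vecs ?K" "v \<in> vecs ?K" 
    then have m: "u \<in> vecs hardy_space" "v \<in> vecs hardy_space" by (simp_all add: K)
    show "ip (vscale ?K c u) v = c * ip u v"
      by (simp add: K hardy_space_simps ip_def mult.assoc)
    show "ip v u = cnj (ip u v)"
      using Bochner_Integration.integral_cnj[of lborel "\<lambda>x. u (Complex x y) * cnj (v (Complex x y))"]
      by (simp add: ip_def mult.commute)
    show "ip u u = complex_of_real ((vnorm ?K u)\<^sup>2)"
    proof -
      have "ip u u = (\<integral>x. complex_of_real ((cmod (u (Complex x y)))\<^sup>2) \<partial>lborel)"
        unfolding ip_def by (simp only: complex_norm_square)
      also have "\<dots> = complex_of_real (\<integral>x. (cmod (u (Complex x y)))\<^sup>2 \<partial>lborel)"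
        by (rule integral_complex_of_real)
      also have "(\<integral>x. (cmod (u (Complex x y)))\<^sup>2 \<partial>lborel) = enn2real (line_norm_sq u y)"
        unfolding line_norm_sq_def using line_square_integrable[OF m(1) y]
        by (intro integral_eq_nn_integral) auto
      finally show ?thesis by (simp add: K y_def)
    qed
    assume "w \<in> vecs ?K"
    then have w: "w \<in> vecs hardy_space" by (simp add: K)
    show "ip (vadd ?K u v) w = ip u w + ip v w"
      unfolding ip_def K hardy_space_simps distrib_right
      by (rule Bochner_Integration.integral_add) (intro int m w)+
  qed
  then show "\<exists>ip. norm_from_inner (hardy_space\<lparr>vnorm := ?p n\<rparr>) ip" by blast
next
  fix u assume u: "u \<in> vecs hardy_space"
  show "(\<lambda>n. sqrt (enn2real (line_norm_sq u (1 / real (Suc n))))) \<longlonglongrightarrow> vnorm hardy_space u"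
    unfolding hardy_space_simps
  proof (intro tendsto_intros tendsto_enn2real)
    show "(\<lambda>n. line_norm_sq u (1 / real (Suc n))) \<longlonglongrightarrow> ennreal (enn2real (hardy_norm_sq u))"
      using line_norm_sq_tendsto[OF u] u by (simp only: hardy_iff ennreal_enn2real infinity_ennreal_def)
  qed simp
qed

lemma hardy_norm_sq_lower_semicontinuous:
  assumes w: "\<And>n. w n holomorphic_on upper_half_plane"
    and lim: "\<And>z. z \<in> upper_half_plane \<Longrightarrow> (\<lambda>n. w n z) \<longlonglongrightarrow> v z"
  shows "hardy_norm_sq v \<le> liminf (\<lambda>n. hardy_norm_sq (w n))"
  unfolding hardy_norm_sq_eq[of v]
proof (rule SUP_least)
  fix y :: real assume "y \<in> {0<..}"
  then have y: "0 < y" by simp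
  note [measurable] = line_measurable[OF w y]
  have "line_norm_sq v y = (\<integral>\<^sup>+ x. liminf (\<lambda>n. ennreal ((cmod (w n (Complex x y)))\<^sup>2)) \<partial>lborel)"
    unfolding line_norm_sq_def
  proof (rule nn_integral_cong)
    fix x
    have "(\<lambda>n. ennreal ((cmod (w n (Complex x y)))\<^sup>2)) \<longlonglongrightarrow> ennreal ((cmod (v (Complex x y)))\<^sup>2)"
      using y by (intro tendsto_ennrealI tendsto_intros lim) (simp add: upper_half_plane_def)
    then show "ennreal ((cmod (v (Complex x y)))\<^sup>2) = liminf (\<lambda>n. ennreal ((cmod (w n (Complex x y)))\<^sup>2))"
      by (rule lim_imp_Liminf[OF trivial_limit_sequentially, symmetric])
  qed
  also have "\<dots> \<le> liminf (\<lambda>n. line_norm_sq (w n) y)"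
    unfolding line_norm_sq_def by (rule nn_integral_liminf) measurable
  also have "\<dots> \<le> liminf (\<lambda>n. hardy_norm_sq (w n))"
    by (intro Liminf_mono always_eventually allI line_norm_sq_le y)
  finally show "line_norm_sq v y \<le> liminf (\<lambda>n. hardy_norm_sq (w n))" .
qed

text \<open>
  Point evaluations turn a Cauchy sequence into a uniform Cauchy sequence on \<open>{z. \<delta> \<le> Im z}\<close> for every
  \<open>\<delta> > 0\<close>, which yields a holomorphic limit; lower semicontinuity of the norm upgrades this to norm
  convergence.
\<close>

lemma hardy_complete:
  assumes X: "\<And>n. X n \<in> vecs hardy_space"
    and cauchy: "\<And>e. 0 < e \<Longrightarrow> \<exists>N. \<forall>m\<ge>N. \<forall>n\<ge>N. hardy_norm_sq (\<lambda>z. X m z - X n z) < ennreal e"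
  shows "\<exists>l\<in>vecs hardy_space. (\<lambda>n. hardy_norm_sq (\<lambda>z. X n z - l z)) \<longlonglongrightarrow> 0"
proof -
  have X_hol: "X n holomorphic_on upper_half_plane" and X_out: "z \<notin> upper_half_plane \<Longrightarrow> X n z = 0" for n z
    using X[of n] by (auto simp: hardy_iff)
  define l where "l z = lim (\<lambda>n. X n z)" for z
  have unif: "uniform_limit {z. \<delta> \<le> Im z} X l sequentially" if \<delta>: "0 < \<delta>" for \<delta>
  proof -
    have "uniformly_Cauchy_on {z. \<delta> \<le> Im z} X"
      unfolding uniformly_Cauchy_on_def
    proof (intro allI impI)
      fix e :: real assume e: "0 < e"
      define e' where "e' = e\<^sup>2 / (2 / (pi * \<delta>))"
      have e': "0 < e'" using e \<delta> by (simp add: e'_def)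
      obtain N where N: "\<forall>m\<ge>N. \<forall>n\<ge>N. hardy_norm_sq (\<lambda>z. X m z - X n z) < ennreal e'"
        using cauchy[OF e'] by blast
      have "dist (X m z) (X n z) < e" if z: "\<delta> \<le> Im z" and mn: "m \<ge> N" "n \<ge> N" for z m n
      proof -
        have "ennreal ((cmod (X m z - X n z))\<^sup>2) \<le> ennreal (2 / (pi * Im z)) * hardy_norm_sq (\<lambda>z. X m z - X n z)"
          using z \<delta> by (intro hardy_pointwise hardy_diff X) auto
        also have "\<dots> \<le> ennreal (2 / (pi * \<delta>)) * hardy_norm_sq (\<lambda>z. X m z - X n z)"
          using z \<delta> by (intro mult_right_mono ennreal_leI frac_le) auto
        also have "\<dots> < ennreal (2 / (pi * \<delta>)) * ennreal e'"
          using N mn \<delta> by (intro ennreal_mult_strict_left_mono) auto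
        also have "\<dots> = ennreal (e\<^sup>2)" using \<delta> e' by (simp add: e'_def flip: ennreal_mult')
        finally have "(cmod (X m z - X n z))\<^sup>2 < e\<^sup>2" using e by (simp add: ennreal_less_iff)
        then show ?thesis using e by (simp add: dist_norm power_less_imp_less_base)
      qed
      then show "\<exists>M. \<forall>z\<in>{z. \<delta> \<le> Im z}. \<forall>m\<ge>M. \<forall>n\<ge>M. dist (X m z) (X n z) < e" by blast
    qed
    then have "uniformly_convergent_on {z. \<delta> \<le> Im z} X" by (rule Cauchy_uniformly_convergent)
    then show ?thesis unfolding uniformly_convergent_uniform_limit_iff l_def .
  qed
  have ptw: "(\<lambda>n. X n z) \<longlonglongrightarrow> l z" if "z \<in> upper_half_plane" for z
    using tendsto_uniform_limitI[OF unif[of "Im z"], of z] that by (simp add: upper_half_plane_def)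
  have l_hol: "l holomorphic_on upper_half_plane"
  proof (rule holomorphic_uniform_sequence[OF open_upper_half_plane X_hol])
    fix z assume z: "z \<in> upper_half_plane"
    define d where "d = Im z / 2"
    have d: "0 < d" using z by (simp add: d_def upper_half_plane_def)
    have sub: "d \<le> Im w" if "w \<in> cball z d" for w
      using abs_Im_le_cmod[of "z - w"] that by (simp add: d_def dist_norm)
    have "cball z d \<subseteq> upper_half_plane"
      using sub d by (fastforce simp: upper_half_plane_def)
    moreover have "uniform_limit (cball z d) X l sequentially"
      by (rule uniform_limit_on_subset[OF unif[OF d]]) (use sub in auto)
    ultimately show "\<exists>d>0. cball z d \<subseteq> upper_half_plane \<and> uniform_limit (cball z d) X l sequentially"
      using d by blast
  qed
  have tail: "\<exists>N. \<forall>n\<ge>N. hardy_norm_sq (\<lambda>z. X n z - l z) \<le> ennreal e" if e: "0 < e" for e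
  proof -
    obtain N where N: "\<forall>m\<ge>N. \<forall>n\<ge>N. hardy_norm_sq (\<lambda>z. X m z - X n z) < ennreal e"
      using cauchy[OF e] by blast
    have "hardy_norm_sq (\<lambda>z. X n z - l z) \<le> ennreal e" if n: "n \<ge> N" for n
    proof -
      have "hardy_norm_sq (\<lambda>z. X n z - l z) \<le> liminf (\<lambda>m. hardy_norm_sq (\<lambda>z. X n z - X m z))"
        by (intro hardy_norm_sq_lower_semicontinuous holomorphic_intros X_hol tendsto_intros ptw)
      also have "\<dots> \<le> liminf (\<lambda>m. ennreal e)"
        by (rule Liminf_mono) (use N n in \<open>auto intro!: eventually_sequentiallyI[of N] less_imp_le\<close>)
      finally show ?thesis by (simp add: Liminf_const)
    qed
    then show ?thesis by blast
  qed
  obtain N where N: "hardy_norm_sq (\<lambda>z. X N z - l z) \<le> ennreal 1" using tail[of 1] by auto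
  have "hardy_norm_sq (\<lambda>z. X N z + (-1) * (X N z - l z)) \<le>
      2 * hardy_norm_sq (X N) + 2 * hardy_norm_sq (\<lambda>z. (-1) * (X N z - l z))"
    by (intro hardy_norm_sq_add_le holomorphic_intros X_hol l_hol)
  also have "hardy_norm_sq (\<lambda>z. (-1) * (X N z - l z)) = hardy_norm_sq (\<lambda>z. X N z - l z)"
    by (simp add: hardy_norm_sq_def norm_minus_commute)
  also have "2 * hardy_norm_sq (X N) + 2 * hardy_norm_sq (\<lambda>z. X N z - l z) < \<infinity>"
    using X[of N] le_less_trans[OF N] by (simp add: hardy_iff ennreal_mult_less_top)
  finally have "hardy_norm_sq l < \<infinity>" by simp
  moreover have "l z = 0" if "z \<notin> upper_half_plane" for z by (simp add: l_def X_out that)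
  ultimately have "l \<in> vecs hardy_space" using l_hol by (simp add: hardy_iff)
  moreover have "(\<lambda>n. hardy_norm_sq (\<lambda>z. X n z - l z)) \<longlonglongrightarrow> 0"
  proof (rule order_tendstoI)
    fix a :: ennreal assume "0 < a"
    then obtain e where e: "0 < e" "ennreal e < a"
    proof (cases a)
      case (real r)
      then have "0 < r / 2" "ennreal (r / 2) < a" using \<open>0 < a\<close> by (auto simp: ennreal_less_iff)
      then show ?thesis by (rule that)
    next
      case top
      then show ?thesis using that[of 1] by simp
    qed
    obtain N where N: "\<forall>n\<ge>N. hardy_norm_sq (\<lambda>z. X n z - l z) \<le> ennreal e" using tail[OF e(1)] by blast
    show "\<forall>\<^sub>F n in sequentially. hardy_norm_sq (\<lambda>z. X n z - l z) < a"
      using eventually_ge_at_top[of N] by eventually_elim (use N e le_less_trans in blast)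
  qed simp
  ultimately show ?thesis by blast
qed

theorem hardy_hilbert_space: "complex_hilbert_space hardy_space"
proof (intro complex_hilbert_space.intro hardy_vector_space complex_hilbert_space_axioms.intro)
  show "0 \<le> vnorm hardy_space u" for u by (simp add: hardy_space_simps)
  show "u = vzero hardy_space" if u: "u \<in> vecs hardy_space" and "vnorm hardy_space u = 0" for u
  proof -
    have h0: "hardy_norm_sq u = 0" using that by (simp add: hardy_norm_sq_conv)
    have "u z = 0" for z
    proof (cases "z \<in> upper_half_plane")
      case True
      then have "ennreal ((cmod (u z))\<^sup>2) \<le> ennreal (2 / (pi * Im z)) * 0"
        using hardy_pointwise[OF u, of z] by (simp add: h0 upper_half_plane_def)
      then show ?thesis by simp
    qed (use u in \<open>simp add: hardy_iff\<close>)
    then show ?thesis by (simp add: hardy_space_simps fun_eq_iff)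
  qed
  show "\<exists>ip. norm_from_inner hardy_space ip" by (rule hardy_norm_inner)
  fix X :: "nat \<Rightarrow> complex \<Rightarrow> complex"
  assume X: "\<And>n. X n \<in> vecs hardy_space"
    and cauchy: "\<And>e. 0 < e \<Longrightarrow> \<exists>N. \<forall>m\<ge>N. \<forall>n\<ge>N. vnorm hardy_space (vdiff hardy_space (X m) (X n)) < e"
  have "\<exists>N. \<forall>m\<ge>N. \<forall>n\<ge>N. hardy_norm_sq (\<lambda>z. X m z - X n z) < ennreal e" if e: "0 < e" for e
  proof -
    obtain N where N: "\<forall>m\<ge>N. \<forall>n\<ge>N. vnorm hardy_space (vdiff hardy_space (X m) (X n)) < sqrt e"
      using cauchy[of "sqrt e"] e by auto
    have "hardy_norm_sq (\<lambda>z. X m z - X n z) < ennreal e" if "m \<ge> N" "n \<ge> N" for m n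
    proof -
      have "(vnorm hardy_space (\<lambda>z. X m z - X n z))\<^sup>2 < (sqrt e)\<^sup>2"
        using N that by (intro power_strict_mono) (auto simp: hardy_space_simps)
      then show ?thesis
        using e by (simp add: hardy_norm_sq_conv[OF hardy_diff[OF X X]] ennreal_lessI)
    qed
    then show ?thesis by blast
  qed
  from hardy_complete[OF X this]
  obtain l where l: "l \<in> vecs hardy_space" "(\<lambda>n. hardy_norm_sq (\<lambda>z. X n z - l z)) \<longlonglongrightarrow> 0"
    by auto
  have "(\<lambda>n. sqrt (enn2real (hardy_norm_sq (\<lambda>z. X n z - l z)))) \<longlonglongrightarrow> sqrt (enn2real 0)"
    using l(2) by (intro tendsto_intros tendsto_enn2real) auto
  then show "\<exists>l\<in>vecs hardy_space. (\<lambda>n. vnorm hardy_space (vdiff hardy_space (X n) l)) \<longlonglongrightarrow> 0"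
    using l(1) by (intro bexI[of _ l]) (simp_all add: hardy_space_simps)
qed

text \<open>
  Uniform convexity: by the parallelogram law \<open>\<parallel>w n - u\<parallel>\<^sup>2 \<le> 4 \<parallel>u\<parallel>\<^sup>2 - \<parallel>w n + u\<parallel>\<^sup>2\<close>, while \<open>w n + u\<close> tends
  pointwise to \<open>2 u\<close> and the norm is lower semicontinuous.
\<close>

lemma hardy_tendsto_if_pointwise:
  assumes w: "\<And>n. w n \<in> vecs hardy_space" and u: "u \<in> vecs hardy_space"
    and le: "\<And>n. hardy_norm_sq (w n) \<le> hardy_norm_sq u"
    and lim: "\<And>z. z \<in> upper_half_plane \<Longrightarrow> (\<lambda>n. w n z) \<longlonglongrightarrow> u z"
  shows "(\<lambda>n. vnorm hardy_space (\<lambda>z. w n z - u z)) \<longlonglongrightarrow> 0"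
proof -
  interpret complex_hilbert_space hardy_space by (rule hardy_hilbert_space)
  let ?n = "vnorm hardy_space"
  have w_hol: "w n holomorphic_on upper_half_plane" and u_hol: "u holomorphic_on upper_half_plane" for n
    using w[of n] u by (auto simp: hardy_iff)
  have para: "(?n (\<lambda>z. w n z + u z))\<^sup>2 + (?n (\<lambda>z. w n z - u z))\<^sup>2 = 2 * (?n (w n))\<^sup>2 + 2 * (?n u)\<^sup>2" for n
    using parallelogram[OF w u, of n] by (simp add: hardy_space_simps(2,4))
  have w_le: "(?n (w n))\<^sup>2 \<le> (?n u)\<^sup>2" for n
    using le[of n] by (simp add: hardy_norm_sq_conv w u)
  have "(?n (\<lambda>z. u z + u z))\<^sup>2 + (?n (\<lambda>z. u z - u z))\<^sup>2 = 2 * (?n u)\<^sup>2 + 2 * (?n u)\<^sup>2"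
    using parallelogram[OF u u] by (simp add: hardy_space_simps(2,4))
  then have double: "(?n (\<lambda>z. u z + u z))\<^sup>2 = 4 * (?n u)\<^sup>2"
    by (simp add: hardy_space_simps(5) hardy_norm_sq_zero)
  have lsc: "ennreal (4 * (?n u)\<^sup>2) \<le> liminf (\<lambda>n. ennreal ((?n (\<lambda>z. w n z + u z))\<^sup>2))"
  proof -
    have "hardy_norm_sq (\<lambda>z. u z + u z) \<le> liminf (\<lambda>n. hardy_norm_sq (\<lambda>z. w n z + u z))"
      by (intro hardy_norm_sq_lower_semicontinuous holomorphic_on_add w_hol u_hol tendsto_add lim tendsto_const)
    then show ?thesis
      by (simp only: hardy_norm_sq_conv[OF hardy_add[OF u u]] hardy_norm_sq_conv[OF hardy_add[OF w u]] double)
  qed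
  have "(\<lambda>n. (?n (\<lambda>z. w n z - u z))\<^sup>2) \<longlonglongrightarrow> 0"
  proof (rule order_tendstoI)
    fix e :: real assume e: "0 < e"
    have "\<forall>\<^sub>F n in sequentially. 4 * (?n u)\<^sup>2 - e < (?n (\<lambda>z. w n z + u z))\<^sup>2"
    proof (cases "0 \<le> 4 * (?n u)\<^sup>2 - e")
      case True
      then have "ennreal (4 * (?n u)\<^sup>2 - e) < ennreal (4 * (?n u)\<^sup>2)"
        using e by (simp add: ennreal_less_iff)
      then have "\<forall>\<^sub>F n in sequentially. ennreal (4 * (?n u)\<^sup>2 - e) < ennreal ((?n (\<lambda>z. w n z + u z))\<^sup>2)"
        using lsc by (intro less_LiminfD) (rule less_le_trans)
      then show ?thesis
        by eventually_elim (use True in \<open>simp add: ennreal_less_iff\<close>)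
    next
      case False
      then show ?thesis by (intro always_eventually allI) (smt (verit) zero_le_power2)
    qed
    then show "\<forall>\<^sub>F n in sequentially. (?n (\<lambda>z. w n z - u z))\<^sup>2 < e"
    proof eventually_elim
      case (elim n)
      then show ?case using para[of n] w_le[of n] by linarith
    qed
  qed (auto intro!: always_eventually intro: less_le_trans)
  then have "(\<lambda>n. sqrt ((?n (\<lambda>z. w n z - u z))\<^sup>2)) \<longlonglongrightarrow> sqrt 0"
    by (rule tendsto_real_sqrt)
  then show ?thesis by (simp add: hardy_space_simps)
qed

section \<open>The logarithmic map\<close>

text \<open>
  With this value the boundary map below sends both \<open>2\<close> and \<open>-2\<close> to \<open>3\<close>.
\<close>

definition \<kappa> :: real where "\<kappa> = 2 / ln 3"

lemma \<kappa>_pos: "0 < \<kappa>" and \<kappa>_ln3: "\<kappa> * ln 3 = 2"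
  by (simp_all add: \<kappa>_def)

definition \<Phi> :: "complex \<Rightarrow> complex" where
  "\<Phi> z = z + 3 + of_real \<kappa> * (Ln (z - 1) - Ln (z + 1))"

text \<open>
  The Nevanlinna kernel equals \<open>(1 + t\<^sup>2) / (t - z) - t\<close>, so this density turns the integral into
  \<open>\<kappa>\<close> times the Cauchy transform of the interval \<open>[-1, 1]\<close>, up to a term odd in \<open>t\<close>.
\<close>

definition \<rho>\<^sub>0 :: "real measure" where
  "\<rho>\<^sub>0 = density lborel (\<lambda>t. ennreal (indicator {-1..1} t * (\<kappa> / (1 + t\<^sup>2))))"

lemma log_integral:
  assumes z: "0 < Im z"
  shows "has_bochner_integral lborel (\<lambda>t. indicator {-1..1} t *\<^sub>R (1 / (of_real t - z))) (Ln (z - 1) - Ln (z + 1))"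
proof -
  have ne: "of_real t - z \<noteq> 0" for t using z by auto
  have nr: "z - of_real t \<notin> \<real>\<^sub>\<le>\<^sub>0" for t using z by (auto simp: complex_nonpos_Reals_iff)
  have "has_bochner_integral lborel (\<lambda>t. indicator {-1..1} t *\<^sub>R (1 / (of_real t - z)))
      (Ln (z - of_real 1) - Ln (z - of_real (-1)))"
  proof (rule has_bochner_integral_FTC_Icc)
    fix t :: real
    have "((\<lambda>w. Ln (z - w)) has_field_derivative 1 / (of_real t - z)) (at (of_real t))"
      using nr[of t] ne[of t] by (auto intro!: derivative_eq_intros simp: field_simps)
    then show "((\<lambda>t. Ln (z - of_real t)) has_vector_derivative 1 / (of_real t - z)) (at t within {-1..1})"
      by (rule has_vector_derivative_real_field)
    show "continuous_on {-1..1} (\<lambda>t. 1 / (of_real t - z))"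
      using ne by (intro continuous_intros) auto
  qed simp
  then show ?thesis by simp
qed

lemma odd_integral:
  "has_bochner_integral lborel (\<lambda>t. indicator {-1..1} t *\<^sub>R (t / (1 + t\<^sup>2))) (0::real)"
proof -
  have pos: "0 < 1 + t\<^sup>2" for t :: real by (simp add: add_pos_nonneg)
  have ne: "1 + t\<^sup>2 \<noteq> 0" for t :: real using pos[of t] by simp
  have "has_bochner_integral lborel (\<lambda>t. indicator {-1..1} t *\<^sub>R (t / (1 + t\<^sup>2)))
     (ln (1 + 1\<^sup>2) / 2 - ln (1 + (-1)\<^sup>2) / (2::real))"
  proof (rule has_bochner_integral_FTC_Icc)
    fix t :: real
    show "((\<lambda>t. ln (1 + t\<^sup>2) / 2) has_vector_derivative t / (1 + t\<^sup>2)) (at t within {-1..1})"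
      unfolding has_real_derivative_iff_has_vector_derivative[symmetric]
      using pos[of t] by (auto intro!: derivative_eq_intros simp: field_simps)
    show "continuous_on {-1..1} (\<lambda>t. t / (1 + t\<^sup>2) :: real)"
      using ne by (intro continuous_intros) auto
  qed simp
  then show ?thesis by simp
qed

lemma nevanlinna_map_eq:
  assumes z: "z \<in> upper_half_plane"
  shows "nevanlinna_map 3 \<rho>\<^sub>0 z = \<Phi> z"
proof -
  have Im: "0 < Im z" using z by (simp add: upper_half_plane_def)
  have ne: "of_real t - z \<noteq> 0" for t using Im by auto
  have ne2: "1 + t\<^sup>2 \<noteq> 0" for t :: real by (metis add_pos_nonneg less_irrefl zero_le_power2 zero_less_one)
  have nec: "1 + (of_real t)\<^sup>2 \<noteq> (0::complex)" for t :: real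
    using ne2[of t] by (metis of_real_1 of_real_add of_real_eq_0_iff of_real_power)
  have cont: "continuous_on UNIV (\<lambda>t. (1 + of_real t * z) / (of_real t - z))"
    using ne by (intro continuous_intros) auto
  have "(\<integral>t. (1 + of_real t * z) / (of_real t - z) \<partial>\<rho>\<^sub>0) =
      (\<integral>t. (indicator {-1..1} t * (\<kappa> / (1 + t\<^sup>2))) *\<^sub>R ((1 + of_real t * z) / (of_real t - z)) \<partial>lborel)"
    unfolding \<rho>\<^sub>0_def
    using \<kappa>_pos borel_measurable_continuous_onI[OF cont]
    by (intro integral_density) (auto intro!: AE_I2)
  also have "\<dots> = (\<integral>t. of_real \<kappa> * (indicator {-1..1} t *\<^sub>R (1 / (of_real t - z))) -
      of_real \<kappa> * of_real (indicator {-1..1} t *\<^sub>R (t / (1 + t\<^sup>2))) \<partial>lborel)"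
  proof (rule Bochner_Integration.integral_cong[OF refl])
    fix t :: real
    have "(1 + of_real t * z) / ((1 + (of_real t)\<^sup>2) * (of_real t - z)) =
        1 / (of_real t - z) - of_real t / (1 + (of_real t)\<^sup>2)"
      using ne[of t] nec[of t] by (simp add: divide_simps) (simp add: algebra_simps power2_eq_square)
    moreover have "(\<kappa> / (1 + t\<^sup>2)) *\<^sub>R ((1 + of_real t * z) / (of_real t - z)) =
        of_real \<kappa> * ((1 + of_real t * z) / ((1 + (of_real t)\<^sup>2) * (of_real t - z)))"
      by (simp add: scaleR_conv_of_real)
    ultimately have "(\<kappa> / (1 + t\<^sup>2)) *\<^sub>R ((1 + of_real t * z) / (of_real t - z)) =
        of_real \<kappa> * (1 / (of_real t - z)) - of_real \<kappa> * of_real (t / (1 + t\<^sup>2))"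
      by (simp add: right_diff_distrib)
    then show "(indicator {-1..1} t * (\<kappa> / (1 + t\<^sup>2))) *\<^sub>R ((1 + of_real t * z) / (of_real t - z)) =
      of_real \<kappa> * (indicator {-1..1} t *\<^sub>R (1 / (of_real t - z))) -
      of_real \<kappa> * of_real (indicator {-1..1} t *\<^sub>R (t / (1 + t\<^sup>2)))"
      by (cases "t \<in> {-1..1}") simp_all
  qed
  also have "\<dots> = of_real \<kappa> * (Ln (z - 1) - Ln (z + 1)) - of_real \<kappa> * of_real 0"
    by (intro has_bochner_integral_integral_eq has_bochner_integral_diff has_bochner_integral_mult_right
        has_bochner_integral_of_real log_integral Im odd_integral)
  finally show ?thesis by (simp add: nevanlinna_map_def \<Phi>_def)
qed

lemma \<rho>\<^sub>0_properties: "finite_measure \<rho>\<^sub>0" "sets \<rho>\<^sub>0 = sets borel" "absolutely_continuous lborel \<rho>\<^sub>0"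
proof
  have "emeasure \<rho>\<^sub>0 (space \<rho>\<^sub>0) = (\<integral>\<^sup>+ t. ennreal (indicator {-1..1} t * (\<kappa> / (1 + t\<^sup>2))) \<partial>lborel)"
    by (simp add: \<rho>\<^sub>0_def emeasure_density)
  also have "\<dots> \<le> (\<integral>\<^sup>+ t. ennreal \<kappa> * indicator {-1..1::real} t \<partial>lborel)"
    using \<kappa>_pos by (intro nn_integral_mono) (auto simp: indicator_def intro!: ennreal_leI mult_imp_div_pos_le add_pos_nonneg)
  also have "\<dots> < \<infinity>" by (simp add: nn_integral_cmult ennreal_mult_less_top)
  finally show "emeasure \<rho>\<^sub>0 (space \<rho>\<^sub>0) \<noteq> \<infinity>" by simp
  show "sets \<rho>\<^sub>0 = sets borel" by (simp add: \<rho>\<^sub>0_def)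
  show "absolutely_continuous lborel \<rho>\<^sub>0" unfolding \<rho>\<^sub>0_def by (rule absolutely_continuousI_density) measurable
qed

lemma Im_log_integral:
  assumes z: "0 < Im z"
  shows "has_bochner_integral lborel (\<lambda>t. indicator {-1..1} t * (Im z / ((t - Re z)\<^sup>2 + (Im z)\<^sup>2))) (Im (Ln (z - 1) - Ln (z + 1)))"
proof -
  have "has_bochner_integral lborel (\<lambda>t. Im (indicator {-1..1} t *\<^sub>R (1 / (of_real t - z)))) (Im (Ln (z - 1) - Ln (z + 1)))"
    by (intro has_bochner_integral_Im log_integral z)
  then show ?thesis by (simp add: Im_divide)
qed

lemma Im_log_nonneg:
  assumes z: "0 < Im z"
  shows "0 \<le> Im (Ln (z - 1) - Ln (z + 1))"
  unfolding has_bochner_integral_integral_eq[OF Im_log_integral[OF z], symmetric]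
  using z by (intro Bochner_Integration.integral_nonneg) simp

text \<open>
  This imaginary part is \<open>\<pi>\<close> times the harmonic measure of \<open>[-1, 1]\<close> seen from \<open>z\<close>. Near the middle of the
  interval it stays away from \<open>0\<close>: the segment of radius \<open>Im z\<close> around \<open>Re z\<close> already contributes \<open>1\<close>.
\<close>

lemma Im_log_ge_one:
  assumes y: "0 < Im z" "Im z \<le> 1 / 2" and x: "\<bar>Re z\<bar> \<le> 1 / 2"
  shows "1 \<le> Im (Ln (z - 1) - Ln (z + 1))"
proof -
  let ?y = "Im z" and ?x = "Re z"
  have "(\<integral>t. indicator {?x - ?y..?x + ?y} t * (1 / (2 * ?y)) \<partial>lborel) \<le>
     (\<integral>t. indicator {-1..1} t * (?y / ((t - ?x)\<^sup>2 + ?y\<^sup>2)) \<partial>lborel)"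
  proof (rule integral_mono)
    show "integrable lborel (\<lambda>t. indicator {-1..1} t * (?y / ((t - ?x)\<^sup>2 + ?y\<^sup>2)))"
      using Im_log_integral[OF y(1)] by (simp only: has_bochner_integral_iff)
    show "integrable lborel (\<lambda>t. indicator {?x - ?y..?x + ?y} t * (1 / (2 * ?y)))"
      by (intro integrable_mult_left integrable_real_indicator) (auto simp: emeasure_lborel_Icc_eq)
    fix t :: real
    show "indicator {?x - ?y..?x + ?y} t * (1 / (2 * ?y)) \<le> indicator {-1..1} t * (?y / ((t - ?x)\<^sup>2 + ?y\<^sup>2))"
    proof (cases "t \<in> {?x - ?y..?x + ?y}")
      case True
      then have "t \<in> {-1..1}" using x y by (auto simp: abs_le_iff)
      have "(t - ?x)\<^sup>2 \<le> ?y\<^sup>2" using True by (intro abs_le_square_iff[THEN iffD1]) auto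
      then have "?y / (2 * ?y\<^sup>2) \<le> ?y / ((t - ?x)\<^sup>2 + ?y\<^sup>2)"
        using y by (intro divide_left_mono mult_pos_pos add_nonneg_pos) auto
      then show ?thesis using True \<open>t \<in> {-1..1}\<close> y by (simp add: power2_eq_square)
    qed (use y in simp)
  qed
  also have "(\<integral>t. indicator {?x - ?y..?x + ?y} t * (1 / (2 * ?y)) \<partial>lborel) = 1"
    using y by simp
  finally show ?thesis
    using has_bochner_integral_integral_eq[OF Im_log_integral[OF y(1)]] by simp
qed

lemma \<Phi>_parabolic: "parabolic_self_map \<Phi>"
  unfolding parabolic_self_map_def
proof (intro conjI ballI)
  show "\<Phi> holomorphic_on upper_half_plane"
    unfolding \<Phi>_def
    by (intro holomorphic_intros) (auto simp: upper_half_plane_def complex_nonpos_Reals_iff)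
  show "Im z \<le> Im (\<Phi> z)" if "z \<in> upper_half_plane" for z
    using Im_log_nonneg[of z] \<kappa>_pos that by (simp add: \<Phi>_def upper_half_plane_def)
  define L where "L s = Ln (\<i> * of_real s - 1) - Ln (\<i> * of_real s + 1)" for s
  have L: "cmod (L s) \<le> 2 * pi" if s: "0 < s" for s
  proof -
    have ne: "\<i> * of_real s - 1 \<noteq> 0" "\<i> * of_real s + 1 \<noteq> 0" using s by (auto simp: complex_eq_iff)
    have "Re (L s) = 0"
      using ne by (simp add: L_def Re_Ln cmod_def)
    moreover have "\<bar>Im (L s)\<bar> \<le> 2 * pi"
      using Im_Ln_le_pi[OF ne(1)] Im_Ln_le_pi[OF ne(2)] mpi_less_Im_Ln[OF ne(1)] mpi_less_Im_Ln[OF ne(2)]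
      by (simp add: L_def abs_le_iff)
    ultimately show ?thesis using cmod_le[of "L s"] by simp
  qed
  have "((\<lambda>s. L s / of_real s) \<longlongrightarrow> 0) at_top"
  proof (rule Lim_null_comparison)
    show "\<forall>\<^sub>F s in at_top. cmod (L s / of_real s) \<le> 2 * pi / s"
      using eventually_gt_at_top[of 0] by eventually_elim (use L in \<open>simp add: norm_divide divide_right_mono\<close>)
    show "((\<lambda>s. 2 * pi / s) \<longlongrightarrow> 0) at_top" by real_asymp
  qed
  moreover have "((\<lambda>s. complex_of_real (3 / s)) \<longlongrightarrow> of_real 0) at_top"
    by (intro tendsto_of_real) real_asymp
  ultimately have "((\<lambda>s. \<i> + complex_of_real (3 / s) + of_real \<kappa> * (L s / of_real s)) \<longlongrightarrow> \<i> + of_real 0 + of_real \<kappa> * 0) at_top"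
    by (intro tendsto_add tendsto_mult tendsto_const)
  then have "((\<lambda>s. \<i> + complex_of_real (3 / s) + of_real \<kappa> * (L s / of_real s)) \<longlongrightarrow> \<i>) at_top" by simp
  then show "((\<lambda>s. \<Phi> (\<i> * of_real s) / of_real s) \<longlongrightarrow> \<i>) at_top"
  proof (rule Lim_transform_eventually)
    show "\<forall>\<^sub>F s in at_top. \<i> + complex_of_real (3 / s) + of_real \<kappa> * (L s / of_real s) = \<Phi> (\<i> * of_real s) / of_real s"
      using eventually_gt_at_top[of 0] by eventually_elim (simp add: \<Phi>_def L_def field_simps)
  qed
qed

lemma \<Phi>_upper_half_plane: "z \<in> upper_half_plane \<Longrightarrow> \<Phi> z \<in> upper_half_plane"
  using \<Phi>_parabolic by (auto simp: parabolic_self_map_def upper_half_plane_def intro: less_le_trans)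

section \<open>Dynamics of the boundary map\<close>

text \<open>
  The quotient is positive on both sides of the interval \<open>[-1, 1]\<close>, so that one formula gives the real
  boundary values of \<open>\<Phi>\<close> on both.
\<close>

definition boundary_map :: "real \<Rightarrow> real" where
  "boundary_map x = x + 3 + \<kappa> * ln ((x - 1) / (x + 1))"

text \<open>
  For \<open>x \<le> -2\<close> the point lies on the branch cuts of the logarithms. Above the real axis both logarithms
  change by the same \<open>\<i> \<pi>\<close> when their arguments are negated, and the resulting formula is continuous at \<open>x\<close>.
\<close>

lemma \<Phi>_boundary:
  assumes x: "2 \<le> \<bar>x\<bar>"
  shows "filterlim \<Phi> (at (of_real (boundary_map x)) within upper_half_plane) (at (of_real x) within upper_half_plane)"
proof -
  have "(\<Phi> \<longlongrightarrow> of_real (boundary_map x)) (at (of_real x) within upper_half_plane)"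
  proof (cases "0 \<le> x")
    case True
    then have x2: "2 \<le> x" using x by simp
    have ln: "Ln (of_real x - 1) = of_real (ln (x - 1))" "Ln (of_real x + 1) = of_real (ln (x + 1))"
      using x2 Ln_of_real[of "x - 1"] Ln_of_real[of "x + 1"] by simp_all
    have "isCont \<Phi> (of_real x)"
      unfolding \<Phi>_def using x2 by (intro continuous_intros) (auto simp: complex_nonpos_Reals_iff)
    moreover have "\<Phi> (of_real x) = of_real (boundary_map x)"
      using x2 by (simp add: \<Phi>_def boundary_map_def ln ln_div)
    ultimately show ?thesis
      by (metis isCont_def filterlim_mono at_le order_refl subset_UNIV)
  next
    case False
    then have x2: "x \<le> - 2" using x by simp
    define \<Psi> where "\<Psi> z = z + 3 + of_real \<kappa> * (Ln (1 - z) - Ln (- 1 - z))" for z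
    have eq: "\<Psi> z = \<Phi> z" if "z \<in> upper_half_plane" for z
    proof -
      have z: "0 < Im z" using that by (simp add: upper_half_plane_def)
      then have "z - 1 \<noteq> 0" "z + 1 \<noteq> 0" by (auto simp: complex_eq_iff)
      then have "Ln (1 - z) = Ln (z - 1) - \<i> * pi" "Ln (- 1 - z) = Ln (z + 1) - \<i> * pi"
        using Ln_minus[of "z - 1"] Ln_minus[of "z + 1"] z by (simp_all add: minus_add_distrib add.commute)
      then show ?thesis by (simp add: \<Psi>_def \<Phi>_def)
    qed
    have ln: "Ln (1 - of_real x) = of_real (ln (1 - x))" "Ln (- 1 - of_real x) = of_real (ln (- 1 - x))"
      using x2 Ln_of_real[of "1 - x"] Ln_of_real[of "- 1 - x"] by simp_all
    have "isCont \<Psi> (of_real x)"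
      unfolding \<Psi>_def using x2 by (intro continuous_intros) (auto simp: complex_nonpos_Reals_iff)
    moreover have "\<Psi> (of_real x) = of_real (boundary_map x)"
    proof -
      have "(x - 1) / (x + 1) = (1 - x) / (- 1 - x)" using x2 by (simp add: field_simps)
      then have "ln ((x - 1) / (x + 1)) = ln (1 - x) - ln (- 1 - x)"
        using x2 by (simp only:) (subst ln_div, auto)
      then show ?thesis by (simp add: \<Psi>_def boundary_map_def ln)
    qed
    ultimately have "(\<Psi> \<longlongrightarrow> of_real (boundary_map x)) (at (of_real x) within upper_half_plane)"
      by (metis isCont_def filterlim_mono at_le order_refl subset_UNIV)
    then show ?thesis
      by (rule Lim_transform_eventually) (auto simp: eventually_at_filter eq)
  qed
  moreover have "\<forall>\<^sub>F z in at (of_real x) within upper_half_plane. \<Phi> z \<in> upper_half_plane \<and> \<Phi> z \<noteq> of_real (boundary_map x)"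
  proof -
    have "\<Phi> z \<in> upper_half_plane \<and> \<Phi> z \<noteq> of_real (boundary_map x)" if "z \<in> upper_half_plane" for z
      using \<Phi>_upper_half_plane[OF that] by (auto simp: upper_half_plane_def)
    then show ?thesis by (auto simp: eventually_at_filter)
  qed
  ultimately show ?thesis by (simp add: filterlim_at)
qed

text \<open>
  Points whose first \<open>n\<close> iterates avoid the hole \<open>(-2, 2)\<close>, so that \<open>\<Phi>\<^sup>n\<close> has a real boundary value there.
\<close>

definition survivors :: "nat \<Rightarrow> real set" where
  "survivors n = {x. \<forall>k<n. 2 \<le> \<bar>(boundary_map ^^ k) x\<bar>}"

lemma survivors_Suc: "x \<in> survivors (Suc n) \<longleftrightarrow> 2 \<le> \<bar>x\<bar> \<and> boundary_map x \<in> survivors n"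
  unfolding survivors_def mem_Collect_eq All_less_Suc2 funpow_Suc_right by simp

lemma \<Phi>_power_boundary:
  assumes "x \<in> survivors n"
  shows "filterlim (\<Phi> ^^ n) (at (of_real ((boundary_map ^^ n) x)) within upper_half_plane) (at (of_real x) within upper_half_plane)"
  using assms
proof (induction n arbitrary: x)
  case 0
  then show ?case by (simp add: filterlim_ident id_def)
next
  case (Suc n)
  have "filterlim (\<lambda>z. (\<Phi> ^^ n) (\<Phi> z)) (at (of_real ((boundary_map ^^ n) (boundary_map x))) within upper_half_plane) (at (of_real x) within upper_half_plane)"
    using Suc by (intro filterlim_compose[OF Suc.IH \<Phi>_boundary]) (simp_all add: survivors_Suc)
  then show ?case by (simp add: funpow_swap1 o_def)
qed

lemma boundary_map_deriv:
  assumes "2 \<le> \<bar>x\<bar>"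
  shows "(boundary_map has_real_derivative 1 + 2 * \<kappa> / (x\<^sup>2 - 1)) (at x)"
proof -
  have ne: "x + 1 \<noteq> 0" "x - 1 \<noteq> 0" using assms by auto
  have pos: "0 < (x - 1) / (x + 1)" using assms by (auto simp: zero_less_divide_iff abs_if split: if_splits)
  have sq: "x\<^sup>2 - 1 = (x + 1) * (x - 1)" by (simp add: power2_eq_square algebra_simps)
  have "((\<lambda>x. (x - 1) / (x + 1)) has_real_derivative ((x + 1) - (x - 1)) / ((x + 1) * (x + 1))) (at x)"
    using ne by (auto intro!: derivative_eq_intros)
  from DERIV_add[OF DERIV_add[OF DERIV_ident DERIV_const[of 3]] DERIV_cmult[OF DERIV_chain2[OF DERIV_ln_divide[OF pos] this], of \<kappa>]]
  have "(boundary_map has_real_derivative 1 + \<kappa> * (1 / ((x - 1) / (x + 1)) * (((x + 1) - (x - 1)) / ((x + 1) * (x + 1))))) (at x)"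
    by (simp only: boundary_map_def[abs_def] add_0_right)
  also have "1 + \<kappa> * (1 / ((x - 1) / (x + 1)) * (((x + 1) - (x - 1)) / ((x + 1) * (x + 1)))) = 1 + 2 * \<kappa> / (x\<^sup>2 - 1)"
    unfolding sq using ne by (simp add: divide_simps) (simp add: algebra_simps)
  finally show ?thesis .
qed

lemma boundary_map_ge:
  assumes "2 \<le> \<bar>x\<bar>"
  shows "x + 1 \<le> boundary_map x"
proof (cases "0 \<le> x")
  case True
  then have x: "2 \<le> x" using assms by simp
  then have "1 / 3 \<le> (x - 1) / (x + 1)" by (simp add: field_simps)
  then have "ln (1 / 3) \<le> ln ((x - 1) / (x + 1))" using x by (subst ln_le_cancel_iff) auto
  then have "\<kappa> * - ln 3 \<le> \<kappa> * ln ((x - 1) / (x + 1))"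
    using \<kappa>_pos by (intro mult_left_mono) (auto simp: ln_div)
  then show ?thesis using \<kappa>_ln3 by (simp add: boundary_map_def)
next
  case False
  then have x: "x \<le> - 2" using assms by simp
  then have "1 \<le> (x - 1) / (x + 1)" by (simp add: field_simps)
  then have "0 \<le> \<kappa> * ln ((x - 1) / (x + 1))" using \<kappa>_pos by simp
  then show ?thesis by (simp add: boundary_map_def)
qed

lemma boundary_map_2: "boundary_map 2 = 3" and boundary_map_minus_2: "boundary_map (- 2) = 3"
  using \<kappa>_ln3 by (simp_all add: boundary_map_def ln_div)

lemma boundary_map_le:
  assumes x: "x \<le> - 2"
  shows "boundary_map x \<le> x + 5"
proof -
  have "(x - 1) / (x + 1) \<le> 3" using x by (simp add: field_simps)
  moreover have "0 < (x - 1) / (x + 1)" using x by (simp add: zero_less_divide_iff)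
  ultimately have "ln ((x - 1) / (x + 1)) \<le> ln 3" by simp
  then have "\<kappa> * ln ((x - 1) / (x + 1)) \<le> 2"
    using \<kappa>_pos \<kappa>_ln3 by (metis mult_le_cancel_left_pos)
  then show ?thesis by (simp add: boundary_map_def)
qed

lemma boundary_map_measurable [measurable]: "boundary_map \<in> borel_measurable borel"
  unfolding boundary_map_def by measurable

lemma boundary_map_power_measurable [measurable]: "(boundary_map ^^ n) \<in> borel_measurable borel"
  by (induction n) (auto intro: measurable_comp)

lemma survivors_measurable [measurable]: "survivors n \<in> sets borel"
  unfolding survivors_def by measurable

text \<open>
  The factor \<open>10\<close> makes the drop of \<open>10 \<kappa> arctan\<close> over one unit step exceed \<open>ln\<close> of the derivative of the
  boundary map.
\<close>

definition weight :: "real \<Rightarrow> real" where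
  "weight x = exp (- (10 * \<kappa> * arctan x))"

lemma weight_measurable [measurable]: "weight \<in> borel_measurable borel"
  unfolding weight_def by (intro borel_measurable_continuous_onI continuous_intros)

lemma weight_bounds: "exp (- (5 * \<kappa> * pi)) \<le> weight x" "weight x \<le> exp (5 * \<kappa> * pi)"
proof -
  have "10 * \<kappa> * arctan x \<le> 10 * \<kappa> * (pi / 2)" "10 * \<kappa> * - (pi / 2) \<le> 10 * \<kappa> * arctan x"
    using arctan_bounded[of x] \<kappa>_pos by (intro mult_left_mono; simp)+
  then show "exp (- (5 * \<kappa> * pi)) \<le> weight x" "weight x \<le> exp (5 * \<kappa> * pi)"
    by (simp_all add: weight_def)
qed

lemma arctan_increment: "1 / (3 * (1 + x\<^sup>2)) \<le> arctan (x + 1) - arctan x"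
proof -
  have "\<exists>s. x < s \<and> s < x + 1 \<and> arctan (x + 1) - arctan x = (x + 1 - x) * inverse (1 + s\<^sup>2)"
    by (rule MVT2) (auto intro!: DERIV_arctan)
  then obtain s where s: "x < s" "s < x + 1" "arctan (x + 1) - arctan x = inverse (1 + s\<^sup>2)" by auto
  have "\<bar>s\<bar> \<le> \<bar>x\<bar> + 1" using s by linarith
  then have "s\<^sup>2 \<le> (\<bar>x\<bar> + 1)\<^sup>2" by (metis abs_ge_zero power2_abs power_mono)
  also have "\<dots> \<le> 2 * x\<^sup>2 + 2"
    using sum_squares_bound[of "\<bar>x\<bar>" 1] by (simp add: power2_sum)
  finally have s2: "s\<^sup>2 \<le> 2 * x\<^sup>2 + 2" .
  have "0 \<le> x\<^sup>2" by simp
  with s2 have "1 + s\<^sup>2 \<le> 3 + 3 * x\<^sup>2" by argo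
  then have "1 + s\<^sup>2 \<le> 3 * (1 + x\<^sup>2)" by (simp add: distrib_left)
  then show ?thesis unfolding s(3) inverse_eq_divide
    by (intro divide_left_mono mult_pos_pos add_pos_nonneg) auto
qed

text \<open>
  The excess \<open>2 \<kappa> / (x\<^sup>2 - 1)\<close> of the derivative over \<open>1\<close> is at most \<open>10 \<kappa> / (3 (1 + x\<^sup>2))\<close> exactly when
  \<open>x\<^sup>2 \<ge> 4\<close>, and this in turn is at most the gain of \<open>10 \<kappa> arctan\<close> along one step, which has length at
  least \<open>1\<close>.
\<close>

lemma weight_boundary_map:
  assumes x: "2 \<le> \<bar>x\<bar>"
  shows "weight (boundary_map x) * (1 + 2 * \<kappa> / (x\<^sup>2 - 1)) \<le> weight x"
proof -
  have x4: "4 \<le> x\<^sup>2" using x power_mono[of 2 "\<bar>x\<bar>" 2] by simp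
  have "2 * \<kappa> / (x\<^sup>2 - 1) \<le> 10 * \<kappa> * (1 / (3 * (1 + x\<^sup>2)))"
  proof -
    have "2 * \<kappa> * (3 * (1 + x\<^sup>2)) \<le> 10 * \<kappa> * (x\<^sup>2 - 1)"
      using mult_left_mono[of "6 * (1 + x\<^sup>2)" "10 * (x\<^sup>2 - 1)" \<kappa>] \<kappa>_pos x4 by (simp add: algebra_simps)
    moreover have "0 < x\<^sup>2 - 1" "0 < 3 * (1 + x\<^sup>2)" using x4 by auto
    ultimately show ?thesis by (simp add: divide_le_eq le_divide_eq mult.commute)
  qed
  also have "\<dots> \<le> 10 * \<kappa> * (arctan (boundary_map x) - arctan x)"
    using arctan_increment[of x] boundary_map_ge[OF x] arctan_monotone'[of "x + 1" "boundary_map x"] \<kappa>_pos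
    by (intro mult_left_mono) auto
  finally have "1 + 2 * \<kappa> / (x\<^sup>2 - 1) \<le> exp (10 * \<kappa> * (arctan (boundary_map x) - arctan x))"
    using exp_ge_add_one_self[of "2 * \<kappa> / (x\<^sup>2 - 1)"] by (meson exp_le_cancel_iff order_trans)
  then have "weight (boundary_map x) * (1 + 2 * \<kappa> / (x\<^sup>2 - 1)) \<le> weight (boundary_map x) * exp (10 * \<kappa> * (arctan (boundary_map x) - arctan x))"
    by (intro mult_left_mono) (auto simp: weight_def)
  also have "\<dots> = weight x" by (simp add: weight_def exp_add[symmetric] algebra_simps)
  finally show ?thesis .
qed

lemma weighted_substitution:
  fixes h :: "real \<Rightarrow> ennreal"
  assumes [measurable]: "h \<in> borel_measurable borel" and ab: "a < b" and far: "\<And>x. x \<in> {a..b} \<Longrightarrow> 2 \<le> \<bar>x\<bar>"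
  shows "(\<integral>\<^sup>+ y. ennreal (weight y) * h y * indicator {boundary_map a..boundary_map b} y \<partial>lborel)
    \<le> (\<integral>\<^sup>+ x. ennreal (weight x) * h (boundary_map x) * indicator {a..b} x \<partial>lborel)"
proof -
  let ?T' = "\<lambda>x. 1 + 2 * \<kappa> / (x\<^sup>2 - 1)"
  have gt: "1 < x\<^sup>2" if "x \<in> {a..b}" for x
    using far[OF that] power_mono[of 2 "\<bar>x\<bar>" 2] by simp
  have "(\<integral>\<^sup>+ y. ennreal (weight y) * h y * indicator {boundary_map a..boundary_map b} y \<partial>lborel) =
      (\<integral>\<^sup>+ x. ennreal (weight (boundary_map x)) * h (boundary_map x) * ennreal (?T' x) * indicator {a..b} x \<partial>lborel)"
  proof (rule nn_integral_substitution_aux)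
    show "continuous_on {a..b} ?T'" using gt by (intro continuous_intros) fastforce
    show "0 \<le> ?T' x" if "x \<in> {a..b}" for x using gt[OF that] \<kappa>_pos by simp
  qed (use boundary_map_deriv far ab in auto)
  also have "\<dots> \<le> (\<integral>\<^sup>+ x. ennreal (weight x) * h (boundary_map x) * indicator {a..b} x \<partial>lborel)"
  proof (rule nn_integral_mono)
    fix x
    show "ennreal (weight (boundary_map x)) * h (boundary_map x) * ennreal (?T' x) * indicator {a..b} x \<le>
        ennreal (weight x) * h (boundary_map x) * indicator {a..b} x"
    proof (cases "x \<in> {a..b}")
      case True
      have "ennreal (weight (boundary_map x)) * ennreal (?T' x) \<le> ennreal (weight x)"
        using weight_boundary_map[OF far[OF True]]
        by (subst ennreal_mult'[symmetric]) (simp_all add: weight_def ennreal_leI)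
      then have "ennreal (weight (boundary_map x)) * ennreal (?T' x) * h (boundary_map x) \<le> ennreal (weight x) * h (boundary_map x)"
        by (intro mult_right_mono) auto
      then show ?thesis using True by (simp add: mult_ac)
    qed simp
  qed
  finally show ?thesis .
qed

text \<open>
  The two branches over \<open>x \<le> -2\<close> and \<open>x \<ge> 2\<close> have images \<open>y \<le> 3\<close> and \<open>y \<ge> 3\<close>, so together they cover the
  line. The substitution rule needs compact intervals, hence the exhaustion by \<open>[3 - n, 3 + n]\<close>.
\<close>

lemma weighted_transfer:
  fixes h :: "real \<Rightarrow> ennreal"
  assumes [measurable]: "h \<in> borel_measurable borel"
  shows "(\<integral>\<^sup>+ y. ennreal (weight y) * h y \<partial>lborel)
    \<le> (\<integral>\<^sup>+ x. ennreal (weight x) * (h (boundary_map x) * indicator {x. 2 \<le> \<bar>x\<bar>} x) \<partial>lborel)"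
    (is "_ \<le> ?R")
proof -
  let ?g = "\<lambda>y. ennreal (weight y) * h y"
  let ?k = "\<lambda>x. ennreal (weight x) * h (boundary_map x)"
  have part: "(\<integral>\<^sup>+ y. ?g y * indicator {3 - real n..3 + real n} y \<partial>lborel) \<le> ?R" if n: "0 < n" for n
  proof -
    let ?A = "{- 2 - real n..- 2}" and ?B = "{2..2 + real n}"
    have left: "boundary_map (- 2 - real n) \<le> 3 - real n" using boundary_map_le[of "- 2 - real n"] by simp
    have right: "3 + real n \<le> boundary_map (2 + real n)" using boundary_map_ge[of "2 + real n"] by simp
    have "(\<integral>\<^sup>+ y. ?g y * indicator {3 - real n..3 + real n} y \<partial>lborel) \<le>
      (\<integral>\<^sup>+ y. ?g y * indicator {boundary_map (- 2 - real n)..boundary_map (- 2)} y + ?g y * indicator {boundary_map 2..boundary_map (2 + real n)} y \<partial>lborel)"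
      using left right by (intro nn_integral_mono) (auto simp: boundary_map_2 boundary_map_minus_2 indicator_def)
    also have "\<dots> = (\<integral>\<^sup>+ y. ?g y * indicator {boundary_map (- 2 - real n)..boundary_map (- 2)} y \<partial>lborel)
      + (\<integral>\<^sup>+ y. ?g y * indicator {boundary_map 2..boundary_map (2 + real n)} y \<partial>lborel)"
      by (rule nn_integral_add) measurable
    also have "\<dots> \<le> (\<integral>\<^sup>+ x. ?k x * indicator ?A x \<partial>lborel) + (\<integral>\<^sup>+ x. ?k x * indicator ?B x \<partial>lborel)"
      using n by (intro add_mono weighted_substitution) auto
    also have "\<dots> = (\<integral>\<^sup>+ x. ?k x * indicator ?A x + ?k x * indicator ?B x \<partial>lborel)"
      by (rule nn_integral_add[symmetric]) measurable
    also have "\<dots> \<le> ?R"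
      by (intro nn_integral_mono) (auto simp: indicator_def)
    finally show ?thesis .
  qed
  have "(\<integral>\<^sup>+ y. ?g y \<partial>lborel) = (\<integral>\<^sup>+ y. liminf (\<lambda>n. ?g y * indicator {3 - real n..3 + real n} y) \<partial>lborel)"
  proof (rule nn_integral_cong)
    fix y :: real
    obtain N where N: "\<bar>y - 3\<bar> \<le> real N" using real_arch_simple by blast
    have "?g y * indicator {3 - real n..3 + real n} y = ?g y" if "N \<le> n" for n
    proof -
      have "y \<in> {3 - real n..3 + real n}" using N that by auto
      then show ?thesis by simp
    qed
    then have "(\<lambda>n. ?g y * indicator {3 - real n..3 + real n} y) \<longlonglongrightarrow> ?g y"
      by (intro tendsto_eventually eventually_sequentiallyI[of N])
    then show "?g y = liminf (\<lambda>n. ?g y * indicator {3 - real n..3 + real n} y)"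
      by (rule lim_imp_Liminf[OF trivial_limit_sequentially, symmetric])
  qed
  also have "\<dots> \<le> liminf (\<lambda>n. \<integral>\<^sup>+ y. ?g y * indicator {3 - real n..3 + real n} y \<partial>lborel)"
    by (rule nn_integral_liminf) measurable
  also have "\<dots> \<le> liminf (\<lambda>n. ?R)"
    by (rule Liminf_mono) (auto intro!: eventually_sequentiallyI[of 1] part)
  finally show ?thesis by (simp add: Liminf_const)
qed

lemma weighted_transfer_power:
  fixes h :: "real \<Rightarrow> ennreal"
  assumes [measurable]: "h \<in> borel_measurable borel"
  shows "(\<integral>\<^sup>+ y. ennreal (weight y) * h y \<partial>lborel)
    \<le> (\<integral>\<^sup>+ x. ennreal (weight x) * (h ((boundary_map ^^ n) x) * indicator (survivors n) x) \<partial>lborel)"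
proof (induction n)
  case 0
  then show ?case by (simp add: survivors_def)
next
  case (Suc n)
  let ?h = "\<lambda>x. h ((boundary_map ^^ n) x) * indicator (survivors n) x"
  have "(\<integral>\<^sup>+ x. ennreal (weight x) * ?h x \<partial>lborel) \<le>
      (\<integral>\<^sup>+ x. ennreal (weight x) * (?h (boundary_map x) * indicator {x. 2 \<le> \<bar>x\<bar>} x) \<partial>lborel)"
    by (rule weighted_transfer) measurable
  also have "\<dots> = (\<integral>\<^sup>+ x. ennreal (weight x) * (h ((boundary_map ^^ Suc n) x) * indicator (survivors (Suc n)) x) \<partial>lborel)"
    by (intro nn_integral_cong) (auto simp: indicator_def survivors_Suc funpow_swap1)
  finally show ?case using Suc.IH by (rule order_trans[rotated])
qed

section \<open>Similarity to an isometry\<close>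

lemma composition_op_power:
  assumes "\<And>z. z \<notin> upper_half_plane \<Longrightarrow> u z = 0" and "\<And>z. z \<in> upper_half_plane \<Longrightarrow> \<phi> z \<in> upper_half_plane"
  shows "(composition_op \<phi> ^^ n) u = composition_op (\<phi> ^^ n) u"
proof (induction n)
  case 0
  show ?case using assms(1) by (auto simp: composition_op_def)
next
  case (Suc n)
  show ?case
    unfolding funpow.simps o_def Suc
    using assms(2) by (auto simp: composition_op_def funpow_swap1)
qed

lemma translation_parabolic:
  assumes "0 \<le> \<epsilon>"
  shows "parabolic_self_map (\<lambda>z. z + of_real \<epsilon> * \<i>)"
  unfolding parabolic_self_map_def
proof (intro conjI ballI)
  have "((\<lambda>s. \<i> + complex_of_real (\<epsilon> / s) * \<i>) \<longlongrightarrow> \<i> + of_real 0 * \<i>) at_top"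
    by (intro tendsto_add tendsto_mult tendsto_of_real tendsto_const) real_asymp
  then have "((\<lambda>s. \<i> + complex_of_real (\<epsilon> / s) * \<i>) \<longlongrightarrow> \<i>) at_top" by simp
  then show "((\<lambda>s. (\<i> * of_real s + of_real \<epsilon> * \<i>) / of_real s) \<longlongrightarrow> \<i>) at_top"
  proof (rule Lim_transform_eventually)
    show "\<forall>\<^sub>F s in at_top. \<i> + complex_of_real (\<epsilon> / s) * \<i> = (\<i> * of_real s + of_real \<epsilon> * \<i>) / of_real s"
      using eventually_gt_at_top[of 0] by eventually_elim (simp add: field_simps)
  qed
qed (use assms in \<open>auto intro!: holomorphic_intros\<close>)

definition translate :: "real \<Rightarrow> (complex \<Rightarrow> complex) \<Rightarrow> (complex \<Rightarrow> complex)" where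
  "translate \<epsilon> = composition_op (\<lambda>z. z + of_real \<epsilon> * \<i>)"

lemma translate_hardy:
  assumes "u \<in> vecs hardy_space" "0 \<le> \<epsilon>"
  shows "translate \<epsilon> u \<in> vecs hardy_space" "hardy_norm_sq (translate \<epsilon> u) \<le> hardy_norm_sq u"
  unfolding translate_def using assms by (auto intro!: composition_op_contraction translation_parabolic)

abbreviation C\<^sub>\<Phi> :: "(complex \<Rightarrow> complex) \<Rightarrow> (complex \<Rightarrow> complex)" where
  "C\<^sub>\<Phi> \<equiv> composition_op \<Phi>"

lemma C_power_hardy:
  assumes "u \<in> vecs hardy_space"
  shows "(C\<^sub>\<Phi> ^^ n) u \<in> vecs hardy_space" "hardy_norm_sq ((C\<^sub>\<Phi> ^^ n) u) \<le> hardy_norm_sq u"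
proof -
  have "(C\<^sub>\<Phi> ^^ n) u \<in> vecs hardy_space \<and> hardy_norm_sq ((C\<^sub>\<Phi> ^^ n) u) \<le> hardy_norm_sq u"
    using assms
    by (induction n) (auto intro: composition_op_contraction[OF \<Phi>_parabolic] order_trans)
  then show "(C\<^sub>\<Phi> ^^ n) u \<in> vecs hardy_space" "hardy_norm_sq ((C\<^sub>\<Phi> ^^ n) u) \<le> hardy_norm_sq u" by auto
qed

text \<open>
  On the real line \<open>C\<^sub>\<Phi>\<^sup>n\<close> of the translate has the boundary values \<open>u (boundary_map\<^sup>n x + \<i> \<epsilon>)\<close> at the
  surviving points \<open>x\<close>. Fatou's lemma bounds their \<open>L\<^sup>2\<close> norm by the Hardy norm, and
  \<open>weighted_transfer_power\<close> bounds it below; the two bounds on the weight give the constant.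
\<close>

lemma C_power_translate_lower_bound:
  assumes u: "u \<in> vecs hardy_space" and \<epsilon>: "0 < \<epsilon>"
  shows "ennreal (exp (- (10 * \<kappa> * pi))) * line_norm_sq u \<epsilon> \<le> hardy_norm_sq ((C\<^sub>\<Phi> ^^ n) (translate \<epsilon> u))"
proof -
  note [measurable] = hardy_measurable[OF u]
  have u_hol: "u holomorphic_on upper_half_plane" using u by (simp add: hardy_iff)
  define v where "v = (C\<^sub>\<Phi> ^^ n) (translate \<epsilon> u)"
  have v: "v \<in> vecs hardy_space"
    unfolding v_def using u \<epsilon> by (intro C_power_hardy translate_hardy) auto
  note [measurable] = hardy_measurable[OF v]
  have \<Phi>n: "(\<Phi> ^^ n) z \<in> upper_half_plane" if "z \<in> upper_half_plane" for z n
    using that by (induction n) (auto intro: \<Phi>_upper_half_plane)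
  have v_eq: "v z = u ((\<Phi> ^^ n) z + of_real \<epsilon> * \<i>)" if "z \<in> upper_half_plane" for z
  proof -
    have "v = composition_op (\<Phi> ^^ n) (translate \<epsilon> u)"
      unfolding v_def translate_def
      by (rule composition_op_power) (auto simp: composition_op_def \<Phi>_upper_half_plane)
    then show ?thesis using that \<Phi>n[OF that] by (simp add: composition_op_def translate_def)
  qed
  define h where "h y = ennreal ((cmod (u (Complex y \<epsilon>)))\<^sup>2)" for y
  have [measurable]: "h \<in> borel_measurable borel" unfolding h_def by measurable
  let ?e = "exp (5 * \<kappa> * pi)"
  have "ennreal (exp (- (5 * \<kappa> * pi))) * line_norm_sq u \<epsilon> =
      (\<integral>\<^sup>+ y. ennreal (exp (- (5 * \<kappa> * pi))) * h y \<partial>lborel)"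
    by (simp add: line_norm_sq_def h_def nn_integral_cmult)
  also have "\<dots> \<le> (\<integral>\<^sup>+ y. ennreal (weight y) * h y \<partial>lborel)"
    by (intro nn_integral_mono mult_right_mono ennreal_leI weight_bounds) auto
  also have "\<dots> \<le> (\<integral>\<^sup>+ x. ennreal (weight x) * (h ((boundary_map ^^ n) x) * indicator (survivors n) x) \<partial>lborel)"
    by (rule weighted_transfer_power) measurable
  also have "\<dots> \<le> (\<integral>\<^sup>+ x. ennreal ?e * (h ((boundary_map ^^ n) x) * indicator (survivors n) x) \<partial>lborel)"
    by (intro nn_integral_mono mult_right_mono ennreal_leI weight_bounds) auto
  also have "\<dots> = ennreal ?e * (\<integral>\<^sup>+ x. h ((boundary_map ^^ n) x) * indicator (survivors n) x \<partial>lborel)"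
    by (rule nn_integral_cmult) measurable
  also have "(\<integral>\<^sup>+ x. h ((boundary_map ^^ n) x) * indicator (survivors n) x \<partial>lborel) \<le>
      (\<integral>\<^sup>+ x. liminf (\<lambda>m. ennreal ((cmod (v (Complex x (1 / real (Suc m)))))\<^sup>2)) \<partial>lborel)"
  proof (rule nn_integral_mono)
    fix x
    show "h ((boundary_map ^^ n) x) * indicator (survivors n) x \<le> liminf (\<lambda>m. ennreal ((cmod (v (Complex x (1 / real (Suc m)))))\<^sup>2))"
    proof (cases "x \<in> survivors n")
      case True
      let ?z = "\<lambda>m. Complex x (1 / real (Suc m))"
      have z_in: "?z m \<in> upper_half_plane" for m by (simp add: upper_half_plane_def)
      have "?z \<longlonglongrightarrow> Complex x 0"
        by (intro tendsto_Complex tendsto_const) real_asymp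
      then have "filterlim ?z (at (of_real x) within upper_half_plane) sequentially"
        unfolding filterlim_at using z_in
        by (auto simp: complex_of_real_def intro!: always_eventually)
      then have "filterlim (\<lambda>m. (\<Phi> ^^ n) (?z m)) (at (of_real ((boundary_map ^^ n) x)) within upper_half_plane) sequentially"
        by (rule filterlim_compose[OF \<Phi>_power_boundary[OF True]])
      then have "(\<lambda>m. (\<Phi> ^^ n) (?z m)) \<longlonglongrightarrow> of_real ((boundary_map ^^ n) x)"
        by (simp add: filterlim_at)
      then have "(\<lambda>m. (\<Phi> ^^ n) (?z m) + of_real \<epsilon> * \<i>) \<longlonglongrightarrow> of_real ((boundary_map ^^ n) x) + of_real \<epsilon> * \<i>"
        by (intro tendsto_add tendsto_const)
      moreover have "of_real ((boundary_map ^^ n) x) + of_real \<epsilon> * \<i> = Complex ((boundary_map ^^ n) x) \<epsilon>"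
        by (simp add: complex_eq_iff)
      ultimately have "(\<lambda>m. (\<Phi> ^^ n) (?z m) + of_real \<epsilon> * \<i>) \<longlonglongrightarrow> Complex ((boundary_map ^^ n) x) \<epsilon>"
        by simp
      moreover have "isCont u (Complex ((boundary_map ^^ n) x) \<epsilon>)"
        using holomorphic_on_imp_continuous_on[OF u_hol] open_upper_half_plane \<epsilon>
        by (auto simp: continuous_on_eq_continuous_at upper_half_plane_def)
      ultimately have "(\<lambda>m. u ((\<Phi> ^^ n) (?z m) + of_real \<epsilon> * \<i>)) \<longlonglongrightarrow> u (Complex ((boundary_map ^^ n) x) \<epsilon>)"
        by (rule isCont_tendsto_compose[rotated])
      then have "(\<lambda>m. ennreal ((cmod (v (?z m)))\<^sup>2)) \<longlonglongrightarrow> h ((boundary_map ^^ n) x)"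
        unfolding h_def v_eq[OF z_in] by (intro tendsto_ennrealI tendsto_power tendsto_norm)
      then show ?thesis
        using True lim_imp_Liminf[OF trivial_limit_sequentially] by (metis indicator_simps(1) mult.right_neutral order_refl)
    qed simp
  qed
  also have "\<dots> \<le> liminf (\<lambda>m. line_norm_sq v (1 / real (Suc m)))"
    unfolding line_norm_sq_def by (rule nn_integral_liminf) measurable
  also have "\<dots> = hardy_norm_sq v"
    by (rule lim_imp_Liminf[OF trivial_limit_sequentially line_norm_sq_tendsto[OF v]])
  finally have "ennreal (exp (- (5 * \<kappa> * pi))) * line_norm_sq u \<epsilon> \<le> ennreal ?e * hardy_norm_sq v"
    by (simp add: mult_left_mono)
  then have "ennreal (exp (- (5 * \<kappa> * pi))) * (ennreal (exp (- (5 * \<kappa> * pi))) * line_norm_sq u \<epsilon>)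
      \<le> ennreal (exp (- (5 * \<kappa> * pi))) * (ennreal ?e * hardy_norm_sq v)"
    by (rule mult_left_mono) simp
  then show ?thesis
    by (simp add: mult.assoc[symmetric] ennreal_mult'[symmetric] exp_add[symmetric] v_def)
qed

text \<open>
  The translates converge to \<open>u\<close> in norm and the powers of \<open>C\<^sub>\<Phi>\<close> are contractions, so the bound for
  translates passes to \<open>u\<close>. The factor \<open>1 / 2\<close> comes from using \<open>|a + b|\<^sup>2 \<le> 2 |a|\<^sup>2 + 2 |b|\<^sup>2\<close> instead of
  the triangle inequality.
\<close>

lemma C_power_lower_bound:
  assumes u: "u \<in> vecs hardy_space"
  shows "sqrt (exp (- (10 * \<kappa> * pi)) / 2) * vnorm hardy_space u \<le> vnorm hardy_space ((C\<^sub>\<Phi> ^^ n) u)"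
proof -
  interpret complex_hilbert_space hardy_space by (rule hardy_hilbert_space)
  have u_hol: "u holomorphic_on upper_half_plane" using u by (simp add: hardy_iff)
  let ?n = "vnorm hardy_space"
  let ?c = "exp (- (10 * \<kappa> * pi))"
  define \<epsilon> where "\<epsilon> m = 1 / real (Suc m)" for m
  have \<epsilon>: "0 < \<epsilon> m" for m by (simp add: \<epsilon>_def)
  define w where "w m = translate (\<epsilon> m) u" for m
  have w: "w m \<in> vecs hardy_space" and w_le: "hardy_norm_sq (w m) \<le> hardy_norm_sq u" for m
    unfolding w_def using translate_hardy[OF u, of "\<epsilon> m"] \<epsilon>[of m] by auto
  have w_lim: "(\<lambda>m. ?n (\<lambda>z. w m z - u z)) \<longlonglongrightarrow> 0"
  proof (rule hardy_tendsto_if_pointwise[OF w u w_le])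
    fix z assume z: "z \<in> upper_half_plane"
    have "isCont u z"
      using holomorphic_on_imp_continuous_on[OF u_hol] z
      unfolding continuous_on_eq_continuous_at[OF open_upper_half_plane] by (rule bspec)
    moreover have "(\<lambda>m. z + of_real (\<epsilon> m) * \<i>) \<longlonglongrightarrow> z + of_real 0 * \<i>"
      unfolding \<epsilon>_def by (intro tendsto_add tendsto_mult tendsto_of_real tendsto_const) real_asymp
    ultimately have "(\<lambda>m. u (z + of_real (\<epsilon> m) * \<i>)) \<longlonglongrightarrow> u z"
      using isCont_tendsto_compose[of z u "\<lambda>m. z + of_real (\<epsilon> m) * \<i>" sequentially] by simp
    then show "(\<lambda>m. w m z) \<longlonglongrightarrow> u z"
      using z by (simp add: w_def translate_def composition_op_def)
  qed
  have bound: "?c * enn2real (line_norm_sq u (\<epsilon> m)) \<le> 2 * (?n ((C\<^sub>\<Phi> ^^ n) u))\<^sup>2 + 2 * (?n (\<lambda>z. w m z - u z))\<^sup>2" for m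
  proof -
    let ?d = "\<lambda>z. w m z - u z"
    have d: "?d \<in> vecs hardy_space" by (rule hardy_diff[OF w u])
    have Cu: "(C\<^sub>\<Phi> ^^ n) u \<in> vecs hardy_space" and Cd: "(C\<^sub>\<Phi> ^^ n) ?d \<in> vecs hardy_space"
      using u d by (auto intro: C_power_hardy)
    have power: "(C\<^sub>\<Phi> ^^ n) f = composition_op (\<Phi> ^^ n) f" if "f \<in> vecs hardy_space" for f
      using that by (intro composition_op_power \<Phi>_upper_half_plane) (simp_all add: hardy_iff)
    have split: "(C\<^sub>\<Phi> ^^ n) (w m) = (\<lambda>z. (C\<^sub>\<Phi> ^^ n) u z + (C\<^sub>\<Phi> ^^ n) ?d z)"
      unfolding power[OF u] power[OF w] power[OF d] by (simp add: composition_op_def fun_eq_iff)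
    have fin: "line_norm_sq u (\<epsilon> m) < top"
      using le_less_trans[OF line_norm_sq_le[OF \<epsilon>, of u m]] u by (simp add: hardy_iff)
    have "ennreal (?c * enn2real (line_norm_sq u (\<epsilon> m))) = ennreal ?c * line_norm_sq u (\<epsilon> m)"
      using fin by (simp add: ennreal_mult')
    also have "\<dots> \<le> hardy_norm_sq ((C\<^sub>\<Phi> ^^ n) (w m))"
      unfolding w_def by (rule C_power_translate_lower_bound[OF u \<epsilon>])
    also have "\<dots> \<le> 2 * hardy_norm_sq ((C\<^sub>\<Phi> ^^ n) u) + 2 * hardy_norm_sq ((C\<^sub>\<Phi> ^^ n) ?d)"
      unfolding split using Cu Cd unfolding hardy_iff by (intro hardy_norm_sq_add_le) simp_all
    also have "\<dots> \<le> 2 * hardy_norm_sq ((C\<^sub>\<Phi> ^^ n) u) + 2 * hardy_norm_sq ?d"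
      by (intro add_left_mono mult_left_mono C_power_hardy d) simp
    also have "\<dots> = ennreal (2 * (?n ((C\<^sub>\<Phi> ^^ n) u))\<^sup>2 + 2 * (?n ?d)\<^sup>2)"
      by (simp add: hardy_norm_sq_conv[OF Cu] hardy_norm_sq_conv[OF d] ennreal_plus ennreal_mult')
    finally show ?thesis by (subst (asm) ennreal_le_iff) simp_all
  qed
  have "?c * (?n u)\<^sup>2 \<le> 2 * (?n ((C\<^sub>\<Phi> ^^ n) u))\<^sup>2 + 2 * 0\<^sup>2"
  proof (rule LIMSEQ_le)
    have "(\<lambda>m. line_norm_sq u (\<epsilon> m)) \<longlonglongrightarrow> ennreal ((?n u)\<^sup>2)"
      using line_norm_sq_tendsto[OF u] by (simp only: \<epsilon>_def hardy_norm_sq_conv[OF u])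
    then show "(\<lambda>m. ?c * enn2real (line_norm_sq u (\<epsilon> m))) \<longlonglongrightarrow> ?c * (?n u)\<^sup>2"
      by (intro tendsto_mult tendsto_const tendsto_enn2real) auto
    show "(\<lambda>m. 2 * (?n ((C\<^sub>\<Phi> ^^ n) u))\<^sup>2 + 2 * (?n (\<lambda>z. w m z - u z))\<^sup>2) \<longlonglongrightarrow> 2 * (?n ((C\<^sub>\<Phi> ^^ n) u))\<^sup>2 + 2 * 0\<^sup>2"
      by (intro tendsto_add tendsto_mult tendsto_power tendsto_const w_lim)
    show "\<exists>N. \<forall>m\<ge>N. ?c * enn2real (line_norm_sq u (\<epsilon> m)) \<le> 2 * (?n ((C\<^sub>\<Phi> ^^ n) u))\<^sup>2 + 2 * (?n (\<lambda>z. w m z - u z))\<^sup>2"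
      using bound by blast
  qed
  then have "?c / 2 * (?n u)\<^sup>2 \<le> (?n ((C\<^sub>\<Phi> ^^ n) u))\<^sup>2" by simp
  then have "sqrt (?c / 2 * (?n u)\<^sup>2) \<le> sqrt ((?n ((C\<^sub>\<Phi> ^^ n) u))\<^sup>2)" by (rule real_sqrt_le_mono)
  then show ?thesis
    using norm_nonneg[OF u] norm_nonneg[OF C_power_hardy(1)[OF u, of n]]
    by (simp only: real_sqrt_mult real_sqrt_abs abs_of_nonneg)
qed

lemma C_linear: "linear_op hardy_space hardy_space C\<^sub>\<Phi>"
  unfolding linear_op_def
proof (intro conjI ballI allI funcsetI)
  show "C\<^sub>\<Phi> u \<in> vecs hardy_space" if "u \<in> vecs hardy_space" for u
    using that by (rule composition_op_contraction[OF \<Phi>_parabolic])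
qed (simp_all add: hardy_space_simps composition_op_def fun_eq_iff)

lemma C_similar_to_isometry: "similar_to_isometry hardy_space C\<^sub>\<Phi>"
proof (rule similar_to_isometry_if_bounded_below[OF hardy_hilbert_space C_linear])
  show "vnorm hardy_space (C\<^sub>\<Phi> u) \<le> vnorm hardy_space u" if u: "u \<in> vecs hardy_space" for u
    using composition_op_contraction[OF \<Phi>_parabolic u] u
    by (simp add: hardy_space_simps hardy_iff enn2real_mono)
  show "0 < sqrt (exp (- (10 * \<kappa> * pi)) / 2)" by simp
qed (rule C_power_lower_bound)

section \<open>Failure of isometry\<close>

text \<open>
  The pole \<open>-\<i>\<close> makes \<open>|test_function (\<Phi> z)|\<^sup>2\<close> a part of \<open>Im (- 1 / (\<Phi> z + \<i>))\<close>, whose integral over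
  lines is at most \<open>\<pi>\<close>, the squared norm of the function itself.
\<close>

definition test_function :: "complex \<Rightarrow> complex" where
  "test_function z = (if z \<in> upper_half_plane then 1 / (z + \<i>) else 0)"

lemma test_function_line:
  assumes "0 < y"
  shows "line_norm_sq test_function y = ennreal (pi / (y + 1))"
proof -
  have "ennreal ((cmod (test_function (Complex x y)))\<^sup>2) =
     ennreal (pi / (y + 1)) * ennreal (poisson_kernel (Complex 0 (y + 1)) x)" for x
  proof -
    have "Complex x y + \<i> = Complex x (y + 1)" by (simp add: complex_eq_iff)
    moreover have "0 < x\<^sup>2 + (y + 1)\<^sup>2" using assms by (intro add_nonneg_pos) auto
    ultimately show ?thesis
      using assms unfolding poisson_kernel_def cmod_real_minus_sq
      by (simp add: test_function_def upper_half_plane_def norm_divide power_divide cmod_power2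
          flip: ennreal_mult')
  qed
  then have "line_norm_sq test_function y =
      ennreal (pi / (y + 1)) * (\<integral>\<^sup>+ x. ennreal (poisson_kernel (Complex 0 (y + 1)) x) \<partial>lborel)"
    by (simp add: line_norm_sq_def nn_integral_cmult)
  also have "(\<integral>\<^sup>+ x. ennreal (poisson_kernel (Complex 0 (y + 1)) x) \<partial>lborel) = 1"
    using has_bochner_integral_poisson_kernel[of "Complex 0 (y + 1)"] assms
    by (subst nn_integral_eq_integral) (auto simp: has_bochner_integral_iff poisson_kernel_nonneg)
  finally show ?thesis by simp
qed

lemma test_function_hardy:
  "test_function \<in> vecs hardy_space" "ennreal pi \<le> hardy_norm_sq test_function"
proof -
  have "(\<lambda>z. 1 / (z + \<i>)) holomorphic_on upper_half_plane"
    by (intro holomorphic_intros) (auto simp: upper_half_plane_def complex_eq_iff)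
  then have hol: "test_function holomorphic_on upper_half_plane"
    by (rule holomorphic_transform) (simp add: test_function_def)
  have "hardy_norm_sq test_function \<le> ennreal pi"
    unfolding hardy_norm_sq_eq by (intro SUP_least) (auto simp: test_function_line intro!: ennreal_leI simp: divide_le_eq)
  then have "hardy_norm_sq test_function < \<infinity>"
    using le_less_trans[OF _ ennreal_less_top] by simp
  with hol show mem: "test_function \<in> vecs hardy_space" by (simp add: hardy_iff test_function_def)
  have "(\<lambda>n. ennreal (pi / (1 / real (Suc n) + 1))) \<longlonglongrightarrow> hardy_norm_sq test_function"
    using line_norm_sq_tendsto[OF mem] by (simp add: test_function_line)
  moreover have "(\<lambda>n. ennreal (pi / (1 / real (Suc n) + 1))) \<longlonglongrightarrow> ennreal pi"
    by (intro tendsto_ennrealI) real_asymp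
  ultimately have "hardy_norm_sq test_function = ennreal pi" by (rule LIMSEQ_unique)
  then show "ennreal pi \<le> hardy_norm_sq test_function" by simp
qed

lemma \<Phi>_bounded_near_interval:
  "\<exists>M>0. \<forall>z. 0 < Im z \<and> Im z \<le> 1 / 2 \<and> \<bar>Re z\<bar> \<le> 1 / 2 \<longrightarrow> cmod (\<Phi> z + \<i>) \<le> M"
proof -
  have B: "cmod (Ln w) \<le> ln 2 + pi" if w: "1 / 2 \<le> cmod w" "cmod w \<le> 2" for w
  proof -
    have w0: "w \<noteq> 0" using w by auto
    have "ln (cmod w) \<le> ln 2" using w w0 by (subst ln_le_cancel_iff) auto
    moreover have "ln (1 / 2) \<le> ln (cmod w)" using w w0 by (subst ln_le_cancel_iff) auto
    then have "- ln 2 \<le> ln (cmod w)" by (simp add: ln_div)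
    ultimately have "\<bar>Re (Ln w)\<bar> \<le> ln 2" unfolding Re_Ln[OF w0] by linarith
    moreover have "\<bar>Im (Ln w)\<bar> \<le> pi" using mpi_less_Im_Ln[OF w0] Im_Ln_le_pi[OF w0] by simp
    ultimately show ?thesis using cmod_le[of "Ln w"] by simp
  qed
  define M where "M = 5 + \<kappa> * (2 * (ln 2 + pi))"
  have "cmod (\<Phi> z + \<i>) \<le> M" if z: "0 < Im z" "Im z \<le> 1 / 2" "\<bar>Re z\<bar> \<le> 1 / 2" for z
  proof -
    have z1: "cmod z \<le> 1" using cmod_le[of z] z by simp
    have upper: "cmod (z - 1) \<le> 2" "cmod (z + 1) \<le> 2"
      using norm_triangle_ineq4[of z 1] norm_triangle_ineq[of z 1] z1 by simp_all
    have "1 / 2 \<le> cmod (z - 1)" "1 / 2 \<le> cmod (z + 1)"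
      using abs_Re_le_cmod[of "z - 1"] abs_Re_le_cmod[of "z + 1"] z(3) by (auto simp: abs_le_iff)
    then have "cmod (Ln (z - 1)) \<le> ln 2 + pi" "cmod (Ln (z + 1)) \<le> ln 2 + pi"
      using upper by (simp_all add: B)
    then have "cmod (Ln (z - 1) - Ln (z + 1)) \<le> 2 * (ln 2 + pi)"
      unfolding mult_2 using norm_triangle_ineq4[of "Ln (z - 1)" "Ln (z + 1)"] by linarith
    then have "cmod (of_real \<kappa> * (Ln (z - 1) - Ln (z + 1))) \<le> \<kappa> * (2 * (ln 2 + pi))"
      using \<kappa>_pos by (simp add: norm_mult)
    moreover have "cmod (\<Phi> z + \<i>) \<le> cmod z + 3 + cmod (of_real \<kappa> * (Ln (z - 1) - Ln (z + 1))) + 1"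
      unfolding \<Phi>_def
      by (intro order_trans[OF norm_triangle_ineq] add_mono) auto
    ultimately show ?thesis using z1 by (simp add: M_def)
  qed
  moreover have "0 < M"
    unfolding M_def using \<kappa>_pos by (intro add_pos_nonneg mult_nonneg_nonneg add_nonneg_nonneg) simp_all
  ultimately show ?thesis by (intro exI[of _ M]) simp
qed

text \<open>
  Since \<open>Im (- 1 / (\<Phi> + \<i>)) = (1 + Im \<Phi>) / |\<Phi> + \<i>|\<^sup>2\<close>, the second summand measures the loss of norm under
  \<open>C\<^sub>\<Phi>\<close>.
\<close>

lemma C_test_function_line:
  assumes y: "0 < y"
  shows "line_norm_sq (C\<^sub>\<Phi> test_function) y +
    (\<integral>\<^sup>+ x. ennreal (Im (\<Phi> (Complex x y)) / (cmod (\<Phi> (Complex x y) + \<i>))\<^sup>2) \<partial>lborel) \<le> ennreal pi"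
proof -
  let ?\<phi> = "\<lambda>x. \<Phi> (Complex x y)"
  have hol: "\<Phi> holomorphic_on upper_half_plane" using \<Phi>_parabolic by (simp add: parabolic_self_map_def)
  note [measurable] = line_measurable[OF hol y]
  have in_uhp: "?\<phi> x \<in> upper_half_plane" for x
    using y by (intro \<Phi>_upper_half_plane) (simp add: upper_half_plane_def)
  have Im_pos: "0 < Im (?\<phi> x)" for x using in_uhp[of x] by (simp add: upper_half_plane_def)
  have Im_meas [measurable]: "(\<lambda>x. Im (?\<phi> x)) \<in> borel_measurable borel"
    by (rule borel_measurable_continuous_on[where f = Im]) (auto intro: continuous_intros)
  have "line_norm_sq (C\<^sub>\<Phi> test_function) y = (\<integral>\<^sup>+ x. ennreal (1 / (cmod (?\<phi> x + \<i>))\<^sup>2) \<partial>lborel)"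
    unfolding composition_op_line_norm_sq[OF y]
    by (simp add: test_function_def in_uhp norm_divide power_divide)
  then have "line_norm_sq (C\<^sub>\<Phi> test_function) y +
    (\<integral>\<^sup>+ x. ennreal (Im (?\<phi> x) / (cmod (?\<phi> x + \<i>))\<^sup>2) \<partial>lborel) =
    (\<integral>\<^sup>+ x. ennreal (1 / (cmod (?\<phi> x + \<i>))\<^sup>2) + ennreal (Im (?\<phi> x) / (cmod (?\<phi> x + \<i>))\<^sup>2) \<partial>lborel)"
    by (simp add: nn_integral_add)
  also have "\<dots> = (\<integral>\<^sup>+ x. ennreal pi * ennreal (poisson_kernel (?\<phi> x - (- \<i>)) 0) \<partial>lborel)"
  proof (rule nn_integral_cong)
    fix x
    have "cmod (of_real 0 - (?\<phi> x - (- \<i>))) = cmod (?\<phi> x + \<i>)"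
      by (simp only: of_real_0 diff_0 norm_minus_cancel diff_minus_eq_add)
    then have "1 / (cmod (?\<phi> x + \<i>))\<^sup>2 + Im (?\<phi> x) / (cmod (?\<phi> x + \<i>))\<^sup>2 = pi * poisson_kernel (?\<phi> x - (- \<i>)) 0"
      unfolding poisson_kernel_def by (simp only:) (simp add: add_divide_distrib[symmetric])
    then show "ennreal (1 / (cmod (?\<phi> x + \<i>))\<^sup>2) + ennreal (Im (?\<phi> x) / (cmod (?\<phi> x + \<i>))\<^sup>2) =
        ennreal pi * ennreal (poisson_kernel (?\<phi> x - (- \<i>)) 0)"
      using Im_pos[of x] by (simp add: ennreal_plus[symmetric] ennreal_mult'[symmetric] less_imp_le del: ennreal_plus)
  qed
  also have "\<dots> = ennreal pi * (\<integral>\<^sup>+ x. ennreal (poisson_kernel (?\<phi> x - (- \<i>)) 0) \<partial>lborel)"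
    by (rule nn_integral_cmult) measurable
  also have "\<dots> \<le> ennreal pi * 1"
    using y by (intro mult_left_mono poisson_mass_le_one[OF \<Phi>_parabolic y]) auto
  finally show ?thesis by simp
qed

text \<open>
  Above \<open>[-1/2, 1/2]\<close> the imaginary part of \<open>\<Phi>\<close> is at least \<open>\<kappa>\<close> down to the real line, so the loss in
  \<open>C_test_function_line\<close> does not vanish in the limit that computes the norm.
\<close>

lemma C_not_isometry: "\<not> isometry_op hardy_space C\<^sub>\<Phi>"
proof
  assume "isometry_op hardy_space C\<^sub>\<Phi>"
  then have "vnorm hardy_space (C\<^sub>\<Phi> test_function) = vnorm hardy_space test_function"
    using test_function_hardy(1) by (simp add: isometry_op_def)
  moreover have mem: "C\<^sub>\<Phi> test_function \<in> vecs hardy_space"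
    by (rule composition_op_contraction[OF \<Phi>_parabolic test_function_hardy(1)])
  ultimately have eq: "hardy_norm_sq (C\<^sub>\<Phi> test_function) = hardy_norm_sq test_function"
    by (simp add: hardy_norm_sq_conv test_function_hardy(1))
  obtain M where M0: "0 < M"
    and M_all: "\<forall>z. 0 < Im z \<and> Im z \<le> 1 / 2 \<and> \<bar>Re z\<bar> \<le> 1 / 2 \<longrightarrow> cmod (\<Phi> z + \<i>) \<le> M"
    using \<Phi>_bounded_near_interval by (elim exE conjE) (rule that)
  have loss: "ennreal (\<kappa> / M\<^sup>2) \<le> (\<integral>\<^sup>+ x. ennreal (Im (\<Phi> (Complex x y)) / (cmod (\<Phi> (Complex x y) + \<i>))\<^sup>2) \<partial>lborel)"
    if y: "0 < y" "y \<le> 1 / 2" for y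
  proof -
    have "ennreal (\<kappa> / M\<^sup>2) = (\<integral>\<^sup>+ x. ennreal (\<kappa> / M\<^sup>2) * indicator {-1/2..1/2::real} x \<partial>lborel)"
      by (simp add: nn_integral_cmult)
    also have "\<dots> \<le> (\<integral>\<^sup>+ x. ennreal (Im (\<Phi> (Complex x y)) / (cmod (\<Phi> (Complex x y) + \<i>))\<^sup>2) \<partial>lborel)"
    proof (rule nn_integral_mono)
      fix x
      let ?\<zeta> = "\<Phi> (Complex x y)"
      show "ennreal (\<kappa> / M\<^sup>2) * indicator {-1/2..1/2} x \<le> ennreal (Im ?\<zeta> / (cmod (?\<zeta> + \<i>))\<^sup>2)"
      proof (cases "x \<in> {-1/2..1/2}")
        case True
        then have x: "\<bar>x\<bar> \<le> 1 / 2" by auto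
        have "\<kappa> * 1 \<le> \<kappa> * Im (Ln (Complex x y - 1) - Ln (Complex x y + 1))"
          using Im_log_ge_one[of "Complex x y"] x y \<kappa>_pos by (intro mult_left_mono) auto
        then have Im: "\<kappa> \<le> Im ?\<zeta>" using y by (simp add: \<Phi>_def)
        have pos: "0 < cmod (?\<zeta> + \<i>)"
          using Im \<kappa>_pos by (auto simp: complex_eq_iff)
        have "\<kappa> / M\<^sup>2 \<le> Im ?\<zeta> / (cmod (?\<zeta> + \<i>))\<^sup>2"
          using Im \<kappa>_pos M_all[rule_format, of "Complex x y"] x y pos
          by (intro frac_le power_mono) auto
        then show ?thesis using True by (simp add: ennreal_leI)
      qed simp
    qed
    finally show ?thesis .
  qed
  have le: "line_norm_sq (C\<^sub>\<Phi> test_function) (1 / real (Suc n)) + ennreal (\<kappa> / M\<^sup>2) \<le> ennreal pi" if n: "1 \<le> n" for n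
  proof -
    have "0 < 1 / real (Suc n)" "1 / real (Suc n) \<le> 1 / 2" using n by (auto simp: field_simps)
    then show ?thesis
      by (intro order_trans[OF add_left_mono[OF loss] C_test_function_line])
  qed
  have "(\<lambda>n. line_norm_sq (C\<^sub>\<Phi> test_function) (1 / real (Suc n)) + ennreal (\<kappa> / M\<^sup>2)) \<longlonglongrightarrow>
      hardy_norm_sq (C\<^sub>\<Phi> test_function) + ennreal (\<kappa> / M\<^sup>2)"
    by (intro tendsto_add line_norm_sq_tendsto mem tendsto_const)
  then have "hardy_norm_sq (C\<^sub>\<Phi> test_function) + ennreal (\<kappa> / M\<^sup>2) \<le> ennreal pi"
    by (rule LIMSEQ_le_const2) (use le in blast)
  then have "ennreal pi + ennreal (\<kappa> / M\<^sup>2) \<le> ennreal pi"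
    using test_function_hardy(2) unfolding eq by (meson add_right_mono order_trans)
  then have "pi + \<kappa> / M\<^sup>2 \<le> pi"
    using \<kappa>_pos by (simp add: ennreal_plus[symmetric] del: ennreal_plus)
  then show False using \<kappa>_pos M0 by (simp add: divide_le_0_iff)
qed

theorem mainTheorem3:
  shows "\<exists>(\<alpha>::real) (\<rho>::real measure).
           finite_measure \<rho> \<and> sets \<rho> = sets borel \<and> absolutely_continuous lborel \<rho> \<and>
           nevanlinna_map \<alpha> \<rho> analytic_on upper_half_plane \<and>
           nevanlinna_map \<alpha> \<rho> \<in> upper_half_plane \<rightarrow> upper_half_plane \<and>
           similar_to_isometry hardy_space (composition_op (nevanlinna_map \<alpha> \<rho>)) \<and>
           \<not> isometry_op hardy_space (composition_op (nevanlinna_map \<alpha> \<rho>))"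
proof (intro exI conjI)
  have C_eq: "composition_op (nevanlinna_map 3 \<rho>\<^sub>0) = C\<^sub>\<Phi>"
    by (intro ext) (simp add: composition_op_def nevanlinna_map_eq)
  show "finite_measure \<rho>\<^sub>0" "sets \<rho>\<^sub>0 = sets borel" "absolutely_continuous lborel \<rho>\<^sub>0"
    by (rule \<rho>\<^sub>0_properties)+
  have "\<Phi> holomorphic_on upper_half_plane" using \<Phi>_parabolic by (simp add: parabolic_self_map_def)
  then have "nevanlinna_map 3 \<rho>\<^sub>0 holomorphic_on upper_half_plane"
    by (rule holomorphic_transform) (simp add: nevanlinna_map_eq)
  then show "nevanlinna_map 3 \<rho>\<^sub>0 analytic_on upper_half_plane"
    by (simp add: analytic_on_open open_upper_half_plane)
  show "nevanlinna_map 3 \<rho>\<^sub>0 \<in> upper_half_plane \<rightarrow> upper_half_plane"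
    by (auto simp: nevanlinna_map_eq \<Phi>_upper_half_plane)
  show "similar_to_isometry hardy_space (composition_op (nevanlinna_map 3 \<rho>\<^sub>0))"
    unfolding C_eq by (rule C_similar_to_isometry)
  show "\<not> isometry_op hardy_space (composition_op (nevanlinna_map 3 \<rho>\<^sub>0))"
    unfolding C_eq by (rule C_not_isometry)
qed

end
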